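(* Let $A$ be a closed invariant subspace of $C(\mathbb{Z}^d)\otimes\mathbb{C}^r$. Then there is a finite set $\Omega\subset\mathbb{C}_*^d$ such that $A$ is the closed linear span of the vectorial $pg$-sequences in $A$ whose geometric indices lie in $\Omega$.
   Context: $C(\mathbb{Z}^d)\otimes\mathbb{C}^r=C(\mathbb{Z}^d;\mathbb{C}^r)$ is the space of all functions $u:\mathbb{Z}^d\to\mathbb{C}^r$ with the topology of coordinatewise (pointwise) convergence. For the standard generators $e_1,\dots,e_d$ of $\mathbb{Z}^d$, the shifts are $(W_iu)(k)=u(k-e_i)$; a subspace $A$ is invariant if $W_iA=A$ for each $i$. $\mathbb{C}_*^d=(\mathbb{C}\setminus\{0\})^d$. A vectorial $pg$-sequence with geometric index $\omega\in\mathbb{C}_*^d$ is a function $k\mapsto\omega^kh(k)$, where $\omega^k=\omega_1^{k_1}\cdots\omega_d^{k_d}$ and $h\in\mathbb{C}[z_1,\dots,z_d]\otimes\mathbb{C}^r$ is a vector of polynomials. *)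

theory Defs
  imports "HOL-Analysis.Analysis" "HOL-Library.Function_Algebras"
begin

text \<open>Elements of C(Z^d) (x) C^r are functions u :: int^'d => complex^'r;
 the space carries the product (pointwise) topology (Function_Topology)
 and the pointwise complex vector space structure given by the scalar
 multiplication below.\<close>

definition cscale :: "complex \<Rightarrow> ('a \<Rightarrow> complex ^ 'r) \<Rightarrow> ('a \<Rightarrow> complex ^ 'r)" where
  "cscale c u = (\<lambda>k. c *s u k)"

definition shift :: "'d::finite \<Rightarrow> (int ^ 'd \<Rightarrow> 'b) \<Rightarrow> (int ^ 'd \<Rightarrow> 'b)" where
  "shift i u = (\<lambda>k. u (k - axis i 1))"

definition invariant_subspace :: "(int ^ 'd::finite \<Rightarrow> complex ^ 'r) set \<Rightarrow> bool" where
  "invariant_subspace A \<longleftrightarrow> (\<forall>i. shift i ` A = A)"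

definition Cstar :: "(complex ^ 'd) set" where
  "Cstar = {\<omega>. \<forall>i. \<omega> $ i \<noteq> 0}"

definition gpow :: "complex ^ 'd::finite \<Rightarrow> int ^ 'd \<Rightarrow> complex" where
  "gpow \<omega> k = (\<Prod>i\<in>UNIV. (\<omega> $ i) powi (k $ i))"

text \<open>Vectorial pg-sequence with geometric index omega: k |-> omega^k h(k), where
 h is a vector of polynomials in d variables, written as a finite sum of
 monomials z^alpha with vector coefficients c alpha in C^r.\<close>
definition pg_seq :: "complex ^ 'd::finite \<Rightarrow> (int ^ 'd \<Rightarrow> complex ^ 'r) \<Rightarrow> bool" where
  "pg_seq \<omega> u \<longleftrightarrow> (\<exists>P c. finite (P :: ('d \<Rightarrow> nat) set) \<and>
      u = (\<lambda>k. gpow \<omega> k *s (\<Sum>\<alpha>\<in>P. (\<Prod>i\<in>UNIV. (of_int (k $ i)) ^ (\<alpha> i)) *s c \<alpha>)))"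

end

theory Submission
  imports Defs "HOL-Library.Poly_Mapping" "HOL-Library.List_Lenlexorder"
    "HOL-Computational_Algebra.Fundamental_Theorem_Algebra"
begin

text \<open>
  The dual of the sequence space is the free module \<open>M\<close> of rank \<open>r\<close> over the Laurent polynomial ring,
  and the annihilator \<open>J\<close> of \<open>A\<close> is a submodule. The ring is Noetherian, so \<open>J\<close> is a finite
  intersection of irreducible submodules. An irreducible submodule is primary; by the Nullstellensatz
  its radical vanishes at some point \<open>\<omega>\<close>, and by Krull's intersection theorem it is the intersection
  of submodules that contain \<open>(z\<^sub>j - \<omega>\<^sub>j)\<^sup>n M\<close> for some \<open>n\<close> and all \<open>j\<close>. The sequences annihilated
  by such a submodule are pg-sequences with index \<open>\<omega>\<close>, and finitely many \<open>\<omega>\<close> suffice. Hence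
  every functional that kills these pg-sequences in \<open>A\<close> lies in \<open>J\<close>, and the Hahn-Banach theorem
  for the product topology concludes.
\<close>

section \<open>Noetherian modules\<close>

text \<open>One point per irreducible component suffices even when its zero set has positive
  dimension: functions that do not vanish at the chosen \<open>\<omega>\<close> act injectively
  modulo the component, so passing to the local ring at \<open>\<omega>\<close> loses nothing. In
  place of localization the proof uses submodules saturated under these functions. Only the set
  \<open>\<Omega>\<close> is uniform. The submodule \<open>K\<close> and the exponents depend on the
  vector \<open>y\<close> to be separated and are unbounded in general, which is why a closure
  appears in the theorem. The way back to sequences rests on an asymmetry: \<open>M\<close> carries
  no topology, so every linear functional on it is a sequence. A functional that kills
  \<open>K\<close> but not \<open>y\<close> is therefore a sequence \<open>w\<close>; it kills
  \<open>J \<subseteq> K\<close>, so it lies in the closed space \<open>A\<close>, and nilpotence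
  modulo \<open>K\<close> makes it a pg-sequence that \<open>y\<close> detects.\<close>

locale noetherian_module = module scale
  for scale :: "'a::comm_ring_1 \<Rightarrow> 'b::ab_group_add \<Rightarrow> 'b" (infixr \<open>\<cdot>\<close> 75) +
  assumes acc: "\<lbrakk>\<And>n. subspace (N n); \<And>n. N n \<subseteq> N (Suc n)\<rbrakk> \<Longrightarrow> \<exists>n::nat. N (Suc n) = N n"
begin

lemma exists_maximal_subspace:
  assumes "X0 \<in> F" and sub: "\<And>X. X \<in> F \<Longrightarrow> subspace X"
  obtains X where "X \<in> F" "\<And>Y. Y \<in> F \<Longrightarrow> X \<subseteq> Y \<Longrightarrow> Y = X"
proof -
  have "wf {(Y, X). X \<in> F \<and> Y \<in> F \<and> X \<subset> Y}"
    unfolding wf_iff_no_infinite_down_chain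
  proof
    assume "\<exists>f. \<forall>i. (f (Suc i), f i) \<in> {(Y, X). X \<in> F \<and> Y \<in> F \<and> X \<subset> Y}"
    then obtain N where N: "\<And>i. N i \<in> F" "\<And>i. N i \<subset> N (Suc i)"
      by (simp add: split_def) metis
    have "\<exists>n. N (Suc n) = N n"
      by (rule acc) (use N sub in blast)+
    with N(2) show False
      by blast
  qed
  then obtain X where X: "X \<in> F"
    "\<And>Y. (Y, X) \<in> {(Y, X). X \<in> F \<and> Y \<in> F \<and> X \<subset> Y} \<Longrightarrow> Y \<notin> F"
    using \<open>X0 \<in> F\<close> by (rule wfE_min) (rule that)
  show thesis
    by (rule that[OF X(1)]) (use X in blast)
qed

text \<open>The submodules \<open>{x. g ^ n \<cdot> x \<in> J}\<close> increase with
  \<open>n\<close>. A repetition makes \<open>g\<close> injective, modulo \<open>J\<close>, on the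
  multiples of \<open>g ^ n\<close>.\<close>

lemma power_colon_stable:
  assumes "subspace J"
  obtains n where "\<And>x. g ^ Suc n \<cdot> x \<in> J \<Longrightarrow> g ^ n \<cdot> x \<in> J"
proof -
  have "\<exists>n. {x. g ^ Suc n \<cdot> x \<in> J} = {x. g ^ n \<cdot> x \<in> J}"
  proof (rule acc)
    show "subspace {x. g ^ n \<cdot> x \<in> J}" for n
      using assms by (auto simp: subspace_def scale_right_distrib) (metis mult.commute scale_scale)
    show "{x. g ^ n \<cdot> x \<in> J} \<subseteq> {x. g ^ Suc n \<cdot> x \<in> J}" for n
      using assms by (auto simp: subspace_def simp flip: scale_scale)
  qed
  then show thesis
    using that by blast
qed

lemma subspace_plus:
  assumes "subspace L" "subspace L'"
  shows "subspace {x + y |x y. x \<in> L \<and> y \<in> L'}"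
proof (rule subspaceI)
  show "0 \<in> {x + y |x y. x \<in> L \<and> y \<in> L'}"
    using assms by (force intro: subspace_0)
next
  fix u v assume "u \<in> {x + y |x y. x \<in> L \<and> y \<in> L'}" "v \<in> {x + y |x y. x \<in> L \<and> y \<in> L'}"
  then obtain x y x' y' where *: "u = x + y" "v = x' + y'" "x \<in> L" "x' \<in> L" "y \<in> L'" "y' \<in> L'"
    by blast
  then have "u + v = (x + x') + (y + y')"
    by simp
  with * assms show "u + v \<in> {x + y |x y. x \<in> L \<and> y \<in> L'}"
    using subspace_add by blast
next
  show "c \<cdot> u \<in> {x + y |x y. x \<in> L \<and> y \<in> L'}" if "u \<in> {x + y |x y. x \<in> L \<and> y \<in> L'}" for c u
    using that assms by (auto simp: scale_right_distrib) (use subspace_scale in blast)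
qed

lemma subspace_multiples: "subspace (range (scale a))"
proof (rule subspaceI)
  show "0 \<in> range (scale a)"
    by (metis rangeI scale_zero_right)
  show "x + y \<in> range (scale a)" if "x \<in> range (scale a)" "y \<in> range (scale a)" for x y
    using that by (auto simp flip: scale_right_distrib)
  show "c \<cdot> x \<in> range (scale a)" if x: "x \<in> range (scale a)" for c x
  proof -
    obtain y where "x = a \<cdot> y"
      using x by blast
    then have "c \<cdot> x = a \<cdot> (c \<cdot> y)"
      by (simp add: mult.commute)
    then show ?thesis
      by blast
  qed
qed

text \<open>A special case of Krull's intersection theorem. The submodule \<open>K\<close> is a maximal saturated
  submodule that contains \<open>J\<close> but not \<open>y\<close>; maximality forces \<open>g\<close> to map \<open>y\<close> into \<open>K\<close>, and then
  a power of \<open>g\<close> to map everything into \<open>K\<close>.\<close>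

lemma saturated_separation:
  assumes J: "subspace J" and y: "y \<notin> J"
    and S1: "1 \<in> S" and Smult: "\<And>s t. s \<in> S \<Longrightarrow> t \<in> S \<Longrightarrow> s * t \<in> S"
    and SG: "\<And>s r g. s \<in> S \<Longrightarrow> g \<in> G \<Longrightarrow> s - r * g \<in> S"
    and satJ: "\<And>s x. s \<in> S \<Longrightarrow> s \<cdot> x \<in> J \<Longrightarrow> x \<in> J"
  obtains K where "subspace K" "J \<subseteq> K" "y \<notin> K" "\<And>g. g \<in> G \<Longrightarrow> \<exists>n. \<forall>x. g ^ n \<cdot> x \<in> K"
proof -
  \<comment> \<open>Saturated submodules correspond to the submodules of the module localized at
    \<open>S\<close>.\<close>
  define F where "F = {K. subspace K \<and> J \<subseteq> K \<and> y \<notin> K \<and> (\<forall>s x. s \<in> S \<longrightarrow> s \<cdot> x \<in> K \<longrightarrow> x \<in> K)}"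
  have "J \<in> F"
    unfolding F_def using J y satJ by blast
  then obtain K where "K \<in> F" and Kmax: "\<And>L. L \<in> F \<Longrightarrow> K \<subseteq> L \<Longrightarrow> L = K"
    by (rule exists_maximal_subspace) (auto simp: F_def)
  then have K: "subspace K" "J \<subseteq> K" "y \<notin> K" and satK: "\<And>s x. s \<in> S \<Longrightarrow> s \<cdot> x \<in> K \<Longrightarrow> x \<in> K"
    by (auto simp: F_def)
  \<comment> \<open>If no \<open>s \<cdot> y\<close> lay in \<open>L\<close>, the saturation
    \<open>L'\<close> would be in \<open>F\<close>, against maximality. So up to \<open>S\<close>
    the vector \<open>y\<close> lies in every submodule strictly above \<open>K\<close>.\<close>
  have larger: "\<exists>s\<in>S. s \<cdot> y \<in> L" if L: "subspace L" "K \<subseteq> L" "\<not> L \<subseteq> K" for L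
  proof (rule ccontr)
    assume no: "\<not> (\<exists>s\<in>S. s \<cdot> y \<in> L)"
    define L' where "L' = {x. \<exists>s\<in>S. s \<cdot> x \<in> L}"
    have "L \<subseteq> L'"
      using S1 by (auto simp: L'_def intro!: bexI[of _ 1])
    have "subspace L'"
    proof (rule subspaceI)
      show "0 \<in> L'"
        using S1 L(1) by (auto simp: L'_def subspace_0)
      show "x + z \<in> L'" if xz: "x \<in> L'" "z \<in> L'" for x z
      proof -
        obtain s t where st: "s \<in> S" "t \<in> S" "s \<cdot> x \<in> L" "t \<cdot> z \<in> L"
          using xz by (auto simp: L'_def)
        have "(s * t) \<cdot> (x + z) = t \<cdot> (s \<cdot> x) + s \<cdot> (t \<cdot> z)"
          by (simp add: scale_right_distrib mult.commute)
        also have "\<dots> \<in> L"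
          by (intro subspace_add subspace_scale L(1) st)
        finally show ?thesis
          using Smult st by (auto simp: L'_def)
      qed
      show "c \<cdot> x \<in> L'" if x: "x \<in> L'" for c x
      proof -
        obtain s where s: "s \<in> S" "s \<cdot> x \<in> L"
          using x by (auto simp: L'_def)
        then have "s \<cdot> (c \<cdot> x) \<in> L"
          using subspace_scale[OF L(1), of "s \<cdot> x" c] by (simp add: mult.commute)
        with s show ?thesis
          by (auto simp: L'_def)
      qed
    qed
    moreover have "x \<in> L'" if "s \<in> S" "s \<cdot> x \<in> L'" for s x
      using that Smult by (auto simp: L'_def)
    ultimately have "L' \<in> F"
      using no K(2) L(2) \<open>L \<subseteq> L'\<close> by (auto simp: F_def L'_def)
    then show False
      using Kmax L \<open>L \<subseteq> L'\<close> by blast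
  qed
  have "\<exists>n. \<forall>x. g ^ n \<cdot> x \<in> K" if g: "g \<in> G" for g
  proof -
    \<comment> \<open>Nakayama's argument: otherwise
      \<open>s \<cdot> y = k + r \<cdot> g \<cdot> y\<close>, so \<open>s - r * g\<close>, again in
      \<open>S\<close>, maps \<open>y\<close> into \<open>K\<close>, and saturation gives
      \<open>y \<in> K\<close>.\<close>
    have gy: "g \<cdot> y \<in> K"
    proof (rule ccontr)
      assume no: "g \<cdot> y \<notin> K"
      define L where "L = {k + x |k x. k \<in> K \<and> x \<in> span {g \<cdot> y}}"
      have "subspace L"
        unfolding L_def by (rule subspace_plus) (use K in auto)
      moreover have "K \<subseteq> L"
        unfolding L_def using span_zero by force
      moreover have "g \<cdot> y \<in> L"
        unfolding L_def using span_base[of "g \<cdot> y" "{g \<cdot> y}"] subspace_0[OF K(1)] by force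
      ultimately obtain s where s: "s \<in> S" "s \<cdot> y \<in> L"
        using no larger by blast
      then obtain k r where "k \<in> K" "s \<cdot> y = k + r \<cdot> g \<cdot> y"
        by (auto simp: L_def span_singleton)
      then have "(s - r * g) \<cdot> y \<in> K"
        by (simp add: scale_left_diff_distrib)
      then show False
        using satK[OF SG[OF s(1) g]] K(3) by blast
    qed
    obtain n where n: "\<And>x. g ^ Suc n \<cdot> x \<in> K \<Longrightarrow> g ^ n \<cdot> x \<in> K"
      using power_colon_stable[OF K(1)] by blast
    \<comment> \<open>If \<open>L\<close> were larger than \<open>K\<close>, then
      \<open>s \<cdot> y = k + g ^ n \<cdot> z\<close> for some \<open>s\<close>. Applying
      \<open>g\<close> sends the left side into \<open>K\<close>, and the choice of \<open>n\<close>
      removes the extra factor \<open>g\<close>.\<close>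
    define L where "L = {k + x |k x. k \<in> K \<and> x \<in> range (scale (g ^ n))}"
    have "L \<subseteq> K"
    proof (rule ccontr)
      assume "\<not> L \<subseteq> K"
      moreover have "subspace L"
        unfolding L_def by (rule subspace_plus) (use K subspace_multiples in auto)
      moreover have "K \<subseteq> L"
        unfolding L_def using subspace_0[OF subspace_multiples, of "g ^ n"] by force
      ultimately obtain s where s: "s \<in> S" "s \<cdot> y \<in> L"
        using larger by blast
      then obtain k z where kz: "k \<in> K" "s \<cdot> y = k + g ^ n \<cdot> z"
        by (auto simp: L_def)
      have "g \<cdot> (s \<cdot> y) - g \<cdot> k \<in> K"
        using gy K(1) kz(1) by (metis scale_left_commute subspace_diff subspace_scale)
      then have "g ^ Suc n \<cdot> z \<in> K"
        by (simp add: kz(2) scale_right_distrib)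
      then have "s \<cdot> y \<in> K"
        using n kz K(1) by (simp add: subspace_add)
      then show False
        using satK s K(3) by blast
    qed
    moreover have "range (scale (g ^ n)) \<subseteq> L"
      unfolding L_def using subspace_0[OF K(1)] by force
    ultimately show ?thesis
      by blast
  qed
  with K show thesis
    using that by blast
qed

text \<open>By Noetherian induction it suffices to treat a submodule \<open>J\<close> that is not the intersection of two
  larger ones. Then every ring element is either injective or nilpotent modulo \<open>J\<close>, the nilpotent
  ones form a proper ideal, and \<open>J\<close> is saturated at every zero of this ideal.\<close>

theorem finite_separating_points:
  fixes ev :: "'p \<Rightarrow> 'a \<Rightarrow> 'k::field"
  assumes ev_one: "\<And>p. p \<in> Z \<Longrightarrow> ev p 1 = 1"
    and ev_diff: "\<And>p f g. p \<in> Z \<Longrightarrow> ev p (f - g) = ev p f - ev p g"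
    and ev_mult: "\<And>p f g. p \<in> Z \<Longrightarrow> ev p (f * g) = ev p f * ev p g"
    and zeros: "\<And>I. module.subspace (*) I \<Longrightarrow> 1 \<notin> I \<Longrightarrow> \<exists>p\<in>Z. \<forall>f\<in>I. ev p f = 0"
    and J: "subspace J"
  shows "\<exists>\<Omega>\<subseteq>Z. finite \<Omega> \<and> (\<forall>y. y \<notin> J \<longrightarrow> (\<exists>p\<in>\<Omega>. \<exists>K. subspace K \<and> J \<subseteq> K \<and> y \<notin> K \<and>
           (\<forall>g. ev p g = 0 \<longrightarrow> (\<exists>n. \<forall>x. g ^ n \<cdot> x \<in> K))))"
    (is "\<exists>\<Omega>\<subseteq>Z. finite \<Omega> \<and> ?sep \<Omega> J")
proof (rule ccontr)
  interpret ring: module "(*) :: 'a \<Rightarrow> 'a \<Rightarrow> 'a"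
    by unfold_locales (simp_all add: algebra_simps)
  \<comment> \<open>The counterexamples. A maximal one is irreducible, because finite point sets
    that work for two larger submodules can be united.\<close>
  define F where "F = {J. subspace J \<and> \<not> (\<exists>\<Omega>\<subseteq>Z. finite \<Omega> \<and> ?sep \<Omega> J)}"
  assume "\<not> (\<exists>\<Omega>\<subseteq>Z. finite \<Omega> \<and> ?sep \<Omega> J)"
  then have "J \<in> F"
    using J by (simp add: F_def)
  then obtain J where "J \<in> F" and Jmax: "\<And>L. L \<in> F \<Longrightarrow> J \<subseteq> L \<Longrightarrow> L = J"
    by (rule exists_maximal_subspace) (auto simp: F_def)
  then have J: "subspace J" and fail: "\<And>\<Omega>. \<Omega> \<subseteq> Z \<Longrightarrow> finite \<Omega> \<Longrightarrow> \<not> ?sep \<Omega> J"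
    by (auto simp: F_def)
  have irreducible: "L1 = J \<or> L2 = J"
    if L: "subspace L1" "subspace L2" "J \<subseteq> L1" "J \<subseteq> L2" "L1 \<inter> L2 \<subseteq> J" for L1 L2
  proof (rule ccontr)
    assume "\<not> ?thesis"
    then have "L1 \<notin> F" "L2 \<notin> F"
      using Jmax L by blast+
    then obtain \<Omega>1 \<Omega>2 where \<Omega>: "\<Omega>1 \<subseteq> Z" "finite \<Omega>1" "?sep \<Omega>1 L1" "\<Omega>2 \<subseteq> Z" "finite \<Omega>2" "?sep \<Omega>2 L2"
      using L(1,2) unfolding F_def by blast
    have "?sep (\<Omega>1 \<union> \<Omega>2) J"
    proof (intro allI impI)
      fix y assume "y \<notin> J"
      then consider "y \<notin> L1" | "y \<notin> L2"
        using L(5) by blast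
      then show "\<exists>p\<in>\<Omega>1 \<union> \<Omega>2. \<exists>K. subspace K \<and> J \<subseteq> K \<and> y \<notin> K \<and>
           (\<forall>g. ev p g = 0 \<longrightarrow> (\<exists>n. \<forall>x. g ^ n \<cdot> x \<in> K))"
      proof cases
        case 1
        then show ?thesis
          using \<Omega>(3) L(3) by (meson UnI1 subset_trans)
      next
        case 2
        then show ?thesis
          using \<Omega>(6) L(4) by (meson UnI2 subset_trans)
      qed
    qed
    then show False
      using fail[of "\<Omega>1 \<union> \<Omega>2"] \<Omega> by blast
  qed
  \<comment> \<open>The Lasker-Noether argument: \<open>L1\<close> and \<open>L2\<close> below meet
    in \<open>J\<close>. By irreducibility one of them is \<open>J\<close>; \<open>L1 = J\<close>
    makes \<open>f\<close> injective and \<open>L2 = J\<close> makes it nilpotent.\<close>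
  have primary: "(\<exists>n. \<forall>x. f ^ n \<cdot> x \<in> J) \<or> (\<forall>x. f \<cdot> x \<in> J \<longrightarrow> x \<in> J)" for f
  proof -
    obtain n where n: "\<And>x. f ^ Suc n \<cdot> x \<in> J \<Longrightarrow> f ^ n \<cdot> x \<in> J"
      using power_colon_stable[OF J] by blast
    define L1 where "L1 = {x. f \<cdot> x \<in> J}"
    define L2 where "L2 = {k + x |k x. k \<in> J \<and> x \<in> range (scale (f ^ n))}"
    have "subspace L1"
      unfolding L1_def using J by (auto simp: subspace_def scale_right_distrib) (metis mult.commute scale_scale)
    moreover have "subspace L2"
      unfolding L2_def by (rule subspace_plus) (use J subspace_multiples in auto)
    moreover have "J \<subseteq> L1"
      unfolding L1_def using J by (auto simp: subspace_scale)
    moreover have "J \<subseteq> L2"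
      unfolding L2_def using subspace_0[OF subspace_multiples, of "f ^ n"] by force
    moreover have "L1 \<inter> L2 \<subseteq> J"
    proof
      fix x assume "x \<in> L1 \<inter> L2"
      then obtain k z where x: "f \<cdot> x \<in> J" "k \<in> J" "x = k + f ^ n \<cdot> z"
        by (auto simp: L1_def L2_def)
      then have "f \<cdot> x - f \<cdot> k \<in> J"
        using J by (simp add: subspace_diff subspace_scale)
      then have "f ^ Suc n \<cdot> z \<in> J"
        by (simp add: x(3) scale_right_distrib)
      then show "x \<in> J"
        using n x J by (simp add: subspace_add)
    qed
    ultimately have "L1 = J \<or> L2 = J"
      by (rule irreducible)
    moreover have "range (scale (f ^ n)) \<subseteq> L2"
      unfolding L2_def using subspace_0[OF J] by force
    ultimately show ?thesis
      unfolding L1_def by blast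
  qed
  \<comment> \<open>The radical of the annihilator of the quotient by \<open>J\<close>.\<close>
  define P where "P = {f. \<exists>n. \<forall>x. f ^ n \<cdot> x \<in> J}"
  have "J \<noteq> UNIV"
    using fail[of "{}"] by auto
  then have "1 \<notin> P"
    by (auto simp: P_def)
  have zero: "f ^ n \<cdot> x \<in> J" if "\<And>x. f ^ m \<cdot> x \<in> J" "m \<le> n" for f m n x
  proof -
    have "f ^ n = f ^ m * f ^ (n - m)"
      using that by (simp flip: power_add)
    then show ?thesis
      using that(1)[of "f ^ (n - m) \<cdot> x"] by simp
  qed
  have "ring.subspace P"
  proof (rule ring.subspaceI)
    show "0 \<in> P"
      using subspace_0[OF J] by (auto simp: P_def intro!: exI[of _ 1])
    show "c * f \<in> P" if "f \<in> P" for c f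
      using that J by (auto simp: P_def power_mult_distrib simp flip: scale_scale intro: subspace_scale)
    show "f + g \<in> P" if fg: "f \<in> P" "g \<in> P" for f g
    proof -
      obtain m n where mn: "\<And>x. f ^ m \<cdot> x \<in> J" "\<And>x. g ^ n \<cdot> x \<in> J"
        using fg by (auto simp: P_def)
      have "(f + g) ^ (m + n) \<cdot> x \<in> J" for x
      proof -
        have "(of_nat (m + n choose k) * f ^ k * g ^ (m + n - k)) \<cdot> x \<in> J" for k
        proof (cases "m \<le> k")
          case True
          then have "f ^ k \<cdot> ((of_nat (m + n choose k) * g ^ (m + n - k)) \<cdot> x) \<in> J"
            by (rule zero[OF mn(1)])
          then show ?thesis
            by (simp only: scale_scale mult_ac)
        next
          case False
          then have "n \<le> m + n - k"
            by simp
          then have "g ^ (m + n - k) \<cdot> ((of_nat (m + n choose k) * f ^ k) \<cdot> x) \<in> J"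
            by (rule zero[OF mn(2)])
          then show ?thesis
            by (simp only: scale_scale mult_ac)
        qed
        then show ?thesis
          unfolding binomial_ring scale_sum_left using J by (blast intro: subspace_sum)
      qed
      then show ?thesis
        by (auto simp: P_def)
    qed
  qed
  with \<open>1 \<notin> P\<close> obtain p where p: "p \<in> Z" "\<And>f. f \<in> P \<Longrightarrow> ev p f = 0"
    using zeros by blast
  have "?sep {p} J"
  proof (intro allI impI)
    fix y assume y: "y \<notin> J"
    obtain K where "subspace K" "J \<subseteq> K" "y \<notin> K"
      "\<And>g. g \<in> {g. ev p g = 0} \<Longrightarrow> \<exists>n. \<forall>x. g ^ n \<cdot> x \<in> K"
    \<comment> \<open>A function with nonzero value at \<open>p\<close> is not in \<open>P\<close>,
      hence injective modulo \<open>J\<close>. Subtracting a multiple of a function that vanishes at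
      \<open>p\<close> does not change the value.\<close>
    proof (rule saturated_separation[OF J y, of "{s. ev p s \<noteq> 0}" "{g. ev p g = 0}"])
      show "x \<in> J" if "s \<in> {s. ev p s \<noteq> 0}" "s \<cdot> x \<in> J" for s x
        using that primary[of s] p(2)[of s] by (auto simp: P_def)
    qed (use p(1) in \<open>auto simp: ev_one ev_mult ev_diff\<close>)
    then show "\<exists>p\<in>{p}. \<exists>K. subspace K \<and> J \<subseteq> K \<and> y \<notin> K \<and>
           (\<forall>g. ev p g = 0 \<longrightarrow> (\<exists>n. \<forall>x. g ^ n \<cdot> x \<in> K))"
      by blast
  qed
  then show False
    using fail[of "{p}"] p(1) by simp
qed

end

section \<open>Modules over Laurent polynomial rings\<close>

lemma nat_seq_incseq_subseq:
  fixes f :: "nat \<Rightarrow> nat"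
  obtains r :: "nat \<Rightarrow> nat" where "strict_mono r" "mono (f \<circ> r)"
proof -
  obtain r :: "nat \<Rightarrow> nat" where r: "strict_mono r" "monoseq (\<lambda>n. f (r n))"
    using seq_monosub[of f] by blast
  show thesis
  proof (cases "mono (f \<circ> r)")
    case True
    then show thesis
      using that r by blast
  next
    case False
    then have dec: "decseq (\<lambda>n. f (r n))"
      using r(2) by (auto simp: monoseq_iff incseq_def mono_def)
    \<comment> \<open>A decreasing sequence is constant from the index of its least value
      on.\<close>
    obtain m where m: "\<And>n. f (r m) \<le> f (r n)"
      using ex_has_least_nat[of "\<lambda>_. True" 0 "\<lambda>n. f (r n)"] by auto
    have "f (r (m + n)) = f (r m)" for n
      using m[of "m + n"] dec by (simp add: decseq_def order_antisym)
    moreover have "strict_mono (\<lambda>n. r (m + n))"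
      using r(1) by (simp add: strict_mono_def)
    ultimately show thesis
      using that[of "\<lambda>n. r (m + n)"] by (simp add: mono_def)
  qed
qed

text \<open>Coordinates are treated one at a time; thinning a subsequence keeps the monotonicity
  already obtained.\<close>

lemma dickson_subseq:
  fixes f :: "nat \<Rightarrow> 'a \<Rightarrow> nat"
  assumes "finite S"
  shows "\<exists>r :: nat \<Rightarrow> nat. strict_mono r \<and> (\<forall>j\<in>S. mono (\<lambda>n. f (r n) j))"
  using assms
proof (induction S rule: finite_induct)
  case empty
  then show ?case
    using strict_mono_id by blast
next
  case (insert i S)
  then obtain r :: "nat \<Rightarrow> nat" where r: "strict_mono r" "\<forall>j\<in>S. mono (\<lambda>n. f (r n) j)"
    by blast
  obtain r' :: "nat \<Rightarrow> nat" where r': "strict_mono r'" "mono ((\<lambda>n. f (r n) i) \<circ> r')"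
    by (rule nat_seq_incseq_subseq)
  have "mono (\<lambda>n. f ((r \<circ> r') n) j)" if "j \<in> insert i S" for j
  proof (cases "j = i")
    case True
    then show ?thesis
      using r'(2) by (simp add: o_def)
  next
    case False
    then show ?thesis
      using that r(2) strict_mono_mono[OF r'(1)] by (simp add: mono_def)
  qed
  then show ?case
    using strict_mono_o[OF r(1) r'(1)] by blast
qed

text \<open>The order on lists compares lengths first, which makes it a well-order on lists of
  naturals. Encoded monomials all have the same length, so only its lexicographic part
  matters.\<close>

lemma list_less_eq_length:
  "length xs = length ys \<Longrightarrow> xs < ys \<longleftrightarrow> (xs, ys) \<in> lex {(u, v). u < v}"
  by (simp add: list_less_def lenlex_def)

lemma map2_add_less_mono:
  fixes xs ys zs :: "nat list"
  assumes "length xs = length zs" "length ys = length zs" "xs < ys"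
  shows "map2 (+) zs xs < map2 (+) zs ys"
proof -
  have "(map2 (+) zs xs, map2 (+) zs ys) \<in> lex {(u, v). u < v}"
    if "(xs, ys) \<in> lex {(u, v). u < v}"
    using assms(1) assms(2)[symmetric] that by (induction xs zs ys rule: list_induct3) auto
  then show ?thesis
    using assms by (simp add: list_less_eq_length)
qed

section \<open>Laurent polynomials as finitely supported functions\<close>

lemma poly_mapping_add_induct [case_names single add]:
  assumes "\<And>k c. P (Poly_Mapping.single k c)"
    and "\<And>f g. P f \<Longrightarrow> P g \<Longrightarrow> P (f + g)"
  shows "P (f :: 'a \<Rightarrow>\<^sub>0 'b::comm_monoid_add)"
proof (induction f rule: update_induct)
  case const
  then show ?case
    using assms(1)[of undefined 0] by simp
next
  case (update f a b)
  then have "Poly_Mapping.lookup f a = 0"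
    by (simp add: in_keys_iff)
  then have "Poly_Mapping.update a b f = Poly_Mapping.single a b + f"
    by (intro poly_mapping_eqI) (auto simp: lookup_update lookup_add lookup_single)
  with update assms show ?case
    by simp
qed

lemma lookup_single_times:
  fixes f :: "'a::ab_group_add \<Rightarrow>\<^sub>0 'b::comm_semiring_1"
  shows "Poly_Mapping.lookup (Poly_Mapping.single a c * f) k = c * Poly_Mapping.lookup f (k - a)"
proof (induction f rule: poly_mapping_add_induct)
  case (single l d)
  show ?case
    by (auto simp: mult_single lookup_single when_def algebra_simps)
next
  case (add f g)
  then show ?case
    by (simp add: distrib_left lookup_add)
qed

text \<open>Multiplication of finitely supported functions is convolution over the group of
  exponents, so this is the Laurent polynomial ring; \<open>single k c\<close> is the term with
  exponent \<open>k\<close> and coefficient \<open>c\<close>.\<close>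

type_synonym 'd laurent = "(int, 'd) vec \<Rightarrow>\<^sub>0 complex"

definition monomials :: "'d::finite laurent ^ 'r::finite \<Rightarrow> ((int ^ 'd) \<times> 'r) set" where
  "monomials x = {(k, i). Poly_Mapping.lookup (x $ i) k \<noteq> 0}"

lemma finite_monomials [simp]: "finite (monomials x)"
proof -
  have "monomials x = (\<Union>i. (\<lambda>k. (k, i)) ` Poly_Mapping.keys (x $ i))"
    by (fastforce simp: monomials_def in_keys_iff)
  then show ?thesis
    by simp
qed

lemma monomials_eq_empty [simp]: "monomials x = {} \<longleftrightarrow> x = 0"
  by (auto simp: monomials_def vec_eq_iff poly_mapping_eq_iff fun_eq_iff)

interpretation laurent_module: module "(*s) :: 'd::finite laurent \<Rightarrow> 'd laurent ^ 'r::finite \<Rightarrow> 'd laurent ^ 'r"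
  by unfold_locales (simp_all add: vec_eq_iff algebra_simps)

text \<open>In a strictly increasing chain pick elements of \<open>N (Suc n) - N n\<close> with nonnegative exponents and
  least leading monomial. By Dickson's lemma one leading monomial divides a later one, and cancelling
  the latter contradicts its minimality.\<close>

lemma laurent_acc:
  fixes N :: "nat \<Rightarrow> ('d::finite laurent ^ 'r::finite) set"
  assumes sub: "\<And>n. laurent_module.subspace (N n)" and inc: "\<And>n. N n \<subseteq> N (Suc n)"
  shows "\<exists>n. N (Suc n) = N n"
proof (rule ccontr)
  assume "\<not> ?thesis"
  then have strict: "\<exists>x. x \<in> N (Suc n) \<and> x \<notin> N n" for n
    using inc by blast
  obtain es :: "'d list" where es: "set es = UNIV" "distinct es"
    using finite_distinct_list[of "UNIV :: 'd set"] by auto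
  obtain idx :: "'r \<Rightarrow> nat" where idx: "inj idx"
    using finite_imp_inj_to_nat_seg[of "UNIV :: 'r set"] by auto
  \<comment> \<open>The last entry encodes the position in the free module. Appending it makes the
    order total on module monomials and compatible with multiplication by a monomial, as long as
    exponents are nonnegative.\<close>
  define enc where "enc = (\<lambda>(k :: int ^ 'd, i). map (\<lambda>j. nat (k $ j)) es @ [idx i])"
  have len: "length (enc q) = Suc (length es)" for q
    by (simp add: enc_def split: prod.split)
  have enc_inj: "k = k' \<and> i = i'"
    if "enc (k, i) = enc (k', i')" "\<And>j. 0 \<le> k $ j" "\<And>j. 0 \<le> k' $ j" for k k' i i'
  proof -
    have "\<forall>j. nat (k $ j) = nat (k' $ j)" "i = i'"
      using that(1) es(1) idx by (auto simp: enc_def inj_eq)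
    then show ?thesis
      using that(2,3) by (simp add: vec_eq_iff eq_nat_nat_iff)
  qed
  have enc_add: "enc (k + a, i) = map2 (+) (map (\<lambda>j. nat (a $ j)) es @ [0]) (enc (k, i))"
    if "\<And>j. 0 \<le> k $ j" "\<And>j. 0 \<le> a $ j" for k a i
    using that by (auto simp: enc_def nat_add_distrib map2_map_map)
  have enc_mono: "enc (k + a, i) \<le> enc (k' + a, i')"
    if "enc (k, i) \<le> enc (k', i')" "\<And>j. 0 \<le> k $ j" "\<And>j. 0 \<le> k' $ j" "\<And>j. 0 \<le> a $ j" for k k' i i' a
    using that map2_add_less_mono[of "enc (k, i)" "map (\<lambda>j. nat (a $ j)) es @ [0]" "enc (k', i')"]
    by (auto simp: enc_add len order_le_less)
  define nonneg where "nonneg x \<longleftrightarrow> (\<forall>(k, i)\<in>monomials x. \<forall>j. 0 \<le> k $ j)" for x :: "'d laurent ^ 'r"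
  define lead where "lead x = Max (enc ` monomials x)" for x :: "'d laurent ^ 'r"
  define D where "D n = {x. x \<in> N (Suc n) \<and> x \<notin> N n \<and> nonneg x}" for n
  have Dne: "\<exists>x. x \<in> D n" for n
  proof -
    obtain x where x: "x \<in> N (Suc n)" "x \<notin> N n"
      using strict by blast
    \<comment> \<open>\<open>B\<close> bounds all exponents of \<open>x\<close> in absolute value,
      so the monomial with exponent \<open>a\<close> clears the negative ones. It is a unit, so the
      product stays outside \<open>N n\<close>.\<close>
    define B where "B = (\<Sum>(k, i)\<in>monomials x. \<Sum>j\<in>UNIV. \<bar>k $ j\<bar>)"
    define a :: "int ^ 'd" where "a = (\<chi> j. B)"
    have B: "\<bar>k $ j\<bar> \<le> B" if "(k, i) \<in> monomials x" for k i j
    proof -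
      have "\<bar>k $ j\<bar> \<le> (\<Sum>j\<in>UNIV. \<bar>k $ j\<bar>)"
        by (rule member_le_sum) auto
      also have "\<dots> = (case (k, i) of (k, i) \<Rightarrow> \<Sum>j\<in>UNIV. \<bar>k $ j\<bar>)"
        by simp
      also have "\<dots> \<le> B"
        unfolding B_def by (rule member_le_sum[OF that]) (auto simp: sum_nonneg)
      finally show ?thesis .
    qed
    define x' where "x' = Poly_Mapping.single a 1 *s x"
    have "x' \<in> N (Suc n)"
      unfolding x'_def by (rule laurent_module.subspace_scale[OF sub x(1)])
    moreover have "x = Poly_Mapping.single (- a) 1 *s x'"
      by (simp add: x'_def vector_smult_assoc mult_single)
    then have "x' \<notin> N n"
      using x(2) laurent_module.subspace_scale[OF sub, of x' n "Poly_Mapping.single (- a) 1"] by auto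
    moreover have "nonneg x'"
      unfolding nonneg_def
    proof clarify
      fix k i j assume "(k, i) \<in> monomials x'"
      then have "(k - a, i) \<in> monomials x"
        by (simp add: monomials_def x'_def lookup_single_times)
      from B[OF this, of j] show "0 \<le> k $ j"
        by (simp add: a_def)
    qed
    ultimately show ?thesis
      by (auto simp: D_def)
  qed
  have "\<exists>x\<in>D n. \<forall>y\<in>D n. lead x \<le> lead y" for n
  proof -
    define l where "l = (LEAST l. \<exists>x\<in>D n. lead x = l)"
    have "\<exists>x\<in>D n. lead x = l"
      unfolding l_def by (rule LeastI_ex) (use Dne in blast)
    moreover have "l \<le> lead y" if "y \<in> D n" for y
      unfolding l_def using that by (intro Least_le) blast
    ultimately show ?thesis
      by blast
  qed
  then obtain x where x: "\<And>n. x n \<in> D n" and xmin: "\<And>n y. y \<in> D n \<Longrightarrow> lead (x n) \<le> lead y"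
    by metis
  have nonzero: "y \<noteq> 0" if "y \<in> D n" for y n
    using that laurent_module.subspace_0[OF sub, of n] by (auto simp: D_def)
  have "\<exists>k i. (k, i) \<in> monomials (x n) \<and> enc (k, i) = lead (x n)" for n
  proof -
    have "lead (x n) \<in> enc ` monomials (x n)"
      unfolding lead_def by (rule Max_in) (simp_all add: nonzero[OF x])
    then show ?thesis
      by fastforce
  qed
  then obtain k i where ki: "\<And>n. (k n, i n) \<in> monomials (x n)" "\<And>n. enc (k n, i n) = lead (x n)"
    by metis
  have nn: "0 \<le> k' $ j" if "(k', i') \<in> monomials (x n)" for k' i' n j
    using that x[of n] by (auto simp: D_def nonneg_def)
  \<comment> \<open>The indicator coordinates \<open>Inr\<close> keep the module position fixed: an
    increasing indicator that is 1 at \<open>r 0\<close> is still 1 at \<open>r 1\<close>.\<close>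
  obtain r :: "nat \<Rightarrow> nat" where r: "strict_mono r"
    and rmono: "\<And>t. mono (\<lambda>n. (\<lambda>n t. case t of Inl j \<Rightarrow> nat (k n $ j) | Inr i' \<Rightarrow> of_bool (i n = i')) (r n) t)"
    using dickson_subseq[of "UNIV :: ('d + 'r) set"
        "\<lambda>n t. case t of Inl j \<Rightarrow> nat (k n $ j) | Inr i' \<Rightarrow> of_bool (i n = i')"] by auto
  define n m where "n = r 0" and "m = r 1"
  have nm: "n < m"
    using r by (simp add: n_def m_def strict_mono_def)
  have le: "k n $ j \<le> k m $ j" for j
    using monoD[OF rmono[of "Inl j"], of 0 1] nn[OF ki(1)] by (simp add: n_def m_def nat_le_eq_zle)
  have "i n = i m"
    using monoD[OF rmono[of "Inr (i n)"], of 0 1] by (auto simp: n_def m_def of_bool_def split: if_splits)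
  \<comment> \<open>The quotient of the two leading monomials; \<open>c\<close> is the quotient of
    the leading coefficients, so the leading term of \<open>x m\<close> cancels in
    \<open>y\<close>.\<close>
  define a where "a = k m - k n"
  define c where "c = Poly_Mapping.lookup (x m $ i m) (k m) / Poly_Mapping.lookup (x n $ i n) (k n)"
  define y where "y = x m - Poly_Mapping.single a c *s x n"
  have a: "0 \<le> a $ j" for j
    using le by (simp add: a_def)
  have coeff_y: "Poly_Mapping.lookup (y $ i') l = Poly_Mapping.lookup (x m $ i') l - c * Poly_Mapping.lookup (x n $ i') (l - a)" for i' l
    by (simp add: y_def lookup_minus lookup_single_times)
  have mon_y: "(\<forall>j. 0 \<le> l $ j) \<and> enc (l, i') < lead (x m)" if l: "(l, i') \<in> monomials y" for l i'
  proof -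
    have "(\<forall>j. 0 \<le> l $ j) \<and> enc (l, i') \<le> lead (x m)"
    proof (cases "(l, i') \<in> monomials (x m)")
      case True
      then have "enc (l, i') \<le> lead (x m)"
        unfolding lead_def by (intro Max_ge) auto
      with nn[OF True] show ?thesis
        by blast
    next
      case False
      then have l': "(l - a, i') \<in> monomials (x n)"
        using l coeff_y[of i' l] by (auto simp: monomials_def)
      then have "enc (l - a, i') \<le> enc (k n, i n)"
        unfolding ki(2) lead_def by (intro Max_ge) auto
      then have "enc (l - a + a, i') \<le> enc (k n + a, i n)"
        by (rule enc_mono) (use nn[OF l'] nn[OF ki(1)] a in auto)
      then have "enc (l, i') \<le> enc (k m, i m)"
        by (simp add: a_def \<open>i n = i m\<close>)
      moreover have "0 \<le> l $ j" for j
        using nn[OF l', of j] a[of j] by simp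
      ultimately show ?thesis
        by (simp add: ki(2))
    qed
    moreover have "enc (l, i') \<noteq> lead (x m)"
    proof
      assume "enc (l, i') = lead (x m)"
      then have "l = k m \<and> i' = i m"
        using calculation nn[OF ki(1)[of m]] by (intro enc_inj) (auto simp: ki(2))
      then have "Poly_Mapping.lookup (y $ i') l = 0"
        using ki(1)[of n] by (simp add: coeff_y a_def c_def \<open>i n = i m\<close> monomials_def)
      with l show False
        by (simp add: monomials_def)
    qed
    ultimately show ?thesis
      by (simp add: order_less_le)
  qed
  \<comment> \<open>The subtracted multiple comes from earlier in the chain and lies in
    \<open>N m\<close>. Hence \<open>y\<close>, like \<open>x m\<close>, is in
    \<open>N (Suc m)\<close> but not in \<open>N m\<close>.\<close>
  have "x n \<in> N m"
    using x[of n] lift_Suc_mono_le[of N "Suc n" m] inc nm by (auto simp: D_def)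
  then have ax: "Poly_Mapping.single a c *s x n \<in> N m"
    by (rule laurent_module.subspace_scale[OF sub])
  have "y \<in> N (Suc m)"
    unfolding y_def using x[of m] ax inc[of m] laurent_module.subspace_diff[OF sub] by (auto simp: D_def)
  moreover have "y \<notin> N m"
  proof
    assume "y \<in> N m"
    then have "y + Poly_Mapping.single a c *s x n \<in> N m"
      using ax laurent_module.subspace_add[OF sub] by blast
    then show False
      using x[of m] by (simp add: y_def D_def)
  qed
  ultimately have "y \<in> D m"
    using mon_y by (auto simp: D_def nonneg_def)
  have "lead y \<in> enc ` monomials y"
    unfolding lead_def by (rule Max_in) (simp_all add: nonzero[OF \<open>y \<in> D m\<close>])
  then have "lead y < lead (x m)"
    using mon_y by auto
  with xmin[OF \<open>y \<in> D m\<close>] show False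
    by simp
qed

interpretation laurent_module: noetherian_module
  "(*s) :: 'd::finite laurent \<Rightarrow> 'd laurent ^ 'r::finite \<Rightarrow> 'd laurent ^ 'r"
  by unfold_locales (rule laurent_acc)

section \<open>The Nullstellensatz\<close>

lemma module_times: "module ((*) :: 'a::comm_ring_1 \<Rightarrow> 'a \<Rightarrow> 'a)"
  by unfold_locales (simp_all add: algebra_simps)

locale maximal_ideal =
  fixes m :: "'a::comm_ring_1 set"
  assumes ideal: "module.subspace (*) m" and proper: "1 \<notin> m"
    and maximal: "\<And>L. module.subspace (*) L \<Longrightarrow> m \<subseteq> L \<Longrightarrow> 1 \<notin> L \<Longrightarrow> L = m"
begin

lemmas add = module.subspace_add[OF module_times ideal]
  and diff = module.subspace_diff[OF module_times ideal]
  and mult = module.subspace_scale[OF module_times ideal]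
  and sum = module.subspace_sum[OF module_times ideal]

text \<open>The ideal generated by \<open>m\<close> and \<open>a\<close> is strictly larger than
  \<open>m\<close>, so it contains 1.\<close>

lemma inverse_mod:
  assumes "a \<notin> m"
  shows "\<exists>q. a * q - 1 \<in> m"
proof -
  define L where "L = {x + a * q |x q. x \<in> m}"
  have LI: "x + a * q \<in> L" if "x \<in> m" for x q
    using that by (auto simp: L_def)
  have zero: "0 \<in> m"
    by (rule module.subspace_0[OF module_times ideal])
  have "module.subspace (*) L"
  proof (rule module.subspaceI[OF module_times])
    show "0 \<in> L"
      using LI[OF zero, of 0] by simp
    show "u + v \<in> L" if "u \<in> L" "v \<in> L" for u v
    proof -
      from that obtain x q y r where "u = x + a * q" "v = y + a * r" "x \<in> m" "y \<in> m"
        by (auto simp: L_def)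
      then have "u + v = (x + y) + a * (q + r)" "x + y \<in> m"
        by (simp_all add: distrib_left add)
      then show ?thesis
        unfolding L_def by blast
    qed
    show "c * u \<in> L" if "u \<in> L" for c u
    proof -
      from that obtain x q where "u = x + a * q" "x \<in> m"
        by (auto simp: L_def)
      then have "c * u = c * x + a * (c * q)" "c * x \<in> m"
        by (simp_all add: distrib_left mult.left_commute mult)
      then show ?thesis
        unfolding L_def by blast
    qed
  qed
  moreover have "m \<subseteq> L"
    using LI[of _ 0] by auto
  moreover have "a \<in> L"
    using LI[OF zero, of 1] by simp
  ultimately have "1 \<in> L"
    using maximal assms by blast
  then obtain x q where x: "x \<in> m" "1 = x + a * q"
    by (auto simp: L_def)
  then have "a * q - 1 = - 1 * x"
    by (simp add: algebra_simps)
  then show ?thesis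
    using mult[OF x(1)] by metis
qed

lemma prime:
  assumes "a * b \<in> m" "a \<notin> m"
  shows "b \<in> m"
proof -
  obtain q where q: "a * q - 1 \<in> m"
    using inverse_mod assms(2) by blast
  have "q * (a * b) - b * (a * q - 1) \<in> m"
    by (rule diff[OF mult[OF assms(1)] mult[OF q]])
  then show ?thesis
    by (simp add: algebra_simps)
qed

end

lemma exists_maximal_ideal:
  fixes I :: "'a::comm_ring_1 set"
  assumes I: "module.subspace (*) I" "1 \<notin> I"
  obtains m where "maximal_ideal m" "I \<subseteq> m"
proof -
  define F where "F = {L. module.subspace (*) L \<and> I \<subseteq> L \<and> 1 \<notin> L}"
  have "\<exists>m\<in>F. \<forall>X\<in>F. m \<subseteq> X \<longrightarrow> X = m"
  proof (rule subset_Zorn_nonempty)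
    show "F \<noteq> {}"
      using I by (auto simp: F_def)
    fix \<C> assume C: "\<C> \<noteq> {}" "subset.chain F \<C>"
    have sub: "module.subspace (*) L" "I \<subseteq> L" "1 \<notin> L" if "L \<in> \<C>" for L
      using C(2) that by (auto simp: F_def subset.chain_def)
    have "module.subspace (*) (\<Union>\<C>)"
    proof (rule module.subspaceI[OF module_times])
      show "0 \<in> \<Union>\<C>"
        using C(1) module.subspace_0[OF module_times sub(1)] by blast
      show "x + y \<in> \<Union>\<C>" if xy: "x \<in> \<Union>\<C>" "y \<in> \<Union>\<C>" for x y
      proof -
        obtain L L' where L: "L \<in> \<C>" "L' \<in> \<C>" "x \<in> L" "y \<in> L'"
          using xy by blast
        then have "L \<subseteq> L' \<or> L' \<subseteq> L"
          using C(2) by (auto simp: subset.chain_def)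
        then show ?thesis
          using L module.subspace_add[OF module_times sub(1)] by blast
      qed
      show "c * x \<in> \<Union>\<C>" if "x \<in> \<Union>\<C>" for c x
        using that module.subspace_scale[OF module_times sub(1)] by blast
    qed
    moreover have "I \<subseteq> \<Union>\<C>" "1 \<notin> \<Union>\<C>"
      using C(1) sub by blast+
    ultimately show "\<Union>\<C> \<in> F"
      by (simp add: F_def)
  qed
  then obtain m where m: "m \<in> F" "\<And>X. X \<in> F \<Longrightarrow> m \<subseteq> X \<Longrightarrow> X = m"
    by blast
  show thesis
  proof
    show "maximal_ideal m"
      using m by unfold_locales (auto simp: F_def)
    show "I \<subseteq> m"
      using m(1) by (simp add: F_def)
  qed
qed

section \<open>The residue field at a maximal ideal\<close>

interpretation group_algebra: vector_space
  "\<lambda>c (f :: 'a::comm_monoid_add \<Rightarrow>\<^sub>0 'b::field). Poly_Mapping.single 0 c * f"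
  by unfold_locales (simp_all add: distrib_left distrib_right single_add mult_single flip: mult.assoc)

lemma in_span_monomials:
  fixes f :: "'a::comm_monoid_add \<Rightarrow>\<^sub>0 'b::field"
  shows "f \<in> group_algebra.span ((\<lambda>k. Poly_Mapping.single k 1) ` Poly_Mapping.keys f)"
proof -
  have "f = (\<Sum>k\<in>Poly_Mapping.keys f. Poly_Mapping.single 0 (Poly_Mapping.lookup f k) * Poly_Mapping.single k 1)"
    by (rule poly_mapping_eqI) (simp add: lookup_sum mult_single lookup_single when_def in_keys_iff)
  also have "\<dots> \<in> group_algebra.span ((\<lambda>k. Poly_Mapping.single k 1) ` Poly_Mapping.keys f)"
    by (intro group_algebra.span_sum group_algebra.span_scale group_algebra.span_base imageI)
  finally show ?thesis .
qed

text \<open>Algebraic relations of \<open>z\<close> over the constants become one-variable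
  polynomials, to which the fundamental theorem of algebra applies.\<close>

definition eval_at :: "('a::comm_monoid_add \<Rightarrow>\<^sub>0 'b::field) \<Rightarrow> 'b poly \<Rightarrow> ('a \<Rightarrow>\<^sub>0 'b)" where
  "eval_at z p = poly (map_poly (Poly_Mapping.single 0) p) z"

lemma eval_at_0 [simp]: "eval_at z 0 = 0"
  by (simp add: eval_at_def)

lemma eval_at_pCons [simp]: "eval_at z (pCons a p) = Poly_Mapping.single 0 a + z * eval_at z p"
  by (simp add: eval_at_def map_poly_pCons)

lemma eval_at_add [simp]: "eval_at z (p + q) = eval_at z p + eval_at z q"
  by (induction p q rule: poly_induct2) (simp_all add: algebra_simps single_add)

lemma eval_at_smult [simp]: "eval_at z (smult c p) = Poly_Mapping.single 0 c * eval_at z p"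
  by (induction p) (simp_all add: algebra_simps mult_single)

lemma eval_at_mult [simp]: "eval_at z (p * q) = eval_at z p * eval_at z q"
  by (induction p) (simp_all add: algebra_simps)

lemma eval_at_1 [simp]: "eval_at z 1 = 1"
  by (simp flip: pCons_one)

lemma eval_at_sum: "eval_at z (\<Sum>x\<in>A. p x) = (\<Sum>x\<in>A. eval_at z (p x))"
  by (induction A rule: infinite_finite_induct) simp_all

lemma eval_at_prod: "eval_at z (\<Prod>x\<in>A. p x) = (\<Prod>x\<in>A. eval_at z (p x))"
  by (induction A rule: infinite_finite_induct) simp_all

text \<open>\<open>p\<close> splits into linear factors, and \<open>M\<close> is prime, so it
  contains one of the factors \<open>z - c\<close>.\<close>

lemma maximal_ideal_root:
  fixes z :: "'k::comm_monoid_add \<Rightarrow>\<^sub>0 complex"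
  assumes "maximal_ideal M" "p \<noteq> 0" "eval_at z p \<in> M"
  shows "\<exists>c. z - Poly_Mapping.single 0 c \<in> M"
  using assms(2,3)
proof (induction "Polynomial.degree p" arbitrary: p)
  case 0
  interpret M: maximal_ideal M by fact
  obtain a where a: "p = [:a:]" "a \<noteq> 0"
    using 0 by (metis degree_eq_zeroE pCons_0_0)
  then have "Poly_Mapping.single 0 (1 / a) * Poly_Mapping.single 0 a \<in> M"
    using 0(3) by (intro M.mult) simp
  then show ?case
    using a(2) M.proper by (simp add: mult_single)
next
  case (Suc n)
  interpret M: maximal_ideal M by fact
  obtain c where "poly p c = 0"
    using Suc(2) fundamental_theorem_of_algebra[of p] by (auto simp: constant_degree)
  then obtain q where q: "p = [:- c, 1:] * q"
    by (auto simp: poly_eq_0_iff_dvd)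
  show ?case
  proof (cases "z - Poly_Mapping.single 0 c \<in> M")
    case False
    have "(z - Poly_Mapping.single 0 c) * eval_at z q \<in> M"
      using Suc.prems(2) unfolding q eval_at_mult by (simp add: single_uminus)
    then have "eval_at z q \<in> M"
      using False M.prime by blast
    moreover have "q \<noteq> 0"
      using q Suc.prems(1) by auto
    moreover have "Polynomial.degree p = Suc (Polynomial.degree q)"
      unfolding q using \<open>q \<noteq> 0\<close> by (subst degree_mult_eq) auto
    ultimately show ?thesis
      using Suc.hyps by simp
  qed blast
qed

text \<open>If there is no such \<open>c\<close>, then \<open>z - c\<close> is invertible modulo \<open>M\<close> for each of the uncountably many \<open>c\<close>. The ring has
  countable dimension, so the inverses are linearly dependent, and clearing denominators shows that
  \<open>z\<close> is algebraic modulo \<open>M\<close>.\<close>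

lemma maximal_ideal_residue_field:
  fixes z :: "'k::{comm_monoid_add,countable} \<Rightarrow>\<^sub>0 complex"
  assumes "maximal_ideal M"
  shows "\<exists>c. z - Poly_Mapping.single 0 c \<in> M"
proof (rule ccontr)
  interpret M: maximal_ideal M by fact
  let ?C = "Poly_Mapping.single 0 :: complex \<Rightarrow> 'k \<Rightarrow>\<^sub>0 complex"
  assume no: "\<not> ?thesis"
  then have "\<forall>c. \<exists>q. (z - ?C c) * q - 1 \<in> M"
    by (simp add: M.inverse_mod)
  then obtain q where q: "\<And>c. (z - ?C c) * q c - 1 \<in> M"
    by metis
  \<comment> \<open>There are countably many finite supports but uncountably many \<open>c\<close>,
    so infinitely many \<open>q c\<close> lie in one finite-dimensional space.\<close>
  have "\<exists>K. infinite {c. Poly_Mapping.keys (q c) = K}"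
  proof (rule ccontr)
    assume fin: "\<not> ?thesis"
    have "(UNIV :: complex set) = (\<Union>K\<in>Collect finite. {c. Poly_Mapping.keys (q c) = K})"
      by auto
    also have "countable \<dots>"
      using fin by (intro countable_UN countable_Collect_finite) (auto intro: countable_finite)
    finally show False
      using uncountable_UNIV_complex by simp
  qed
  then obtain K where K: "infinite {c. Poly_Mapping.keys (q c) = K}" ..
  \<comment> \<open>If \<open>q c = q d\<close>, subtracting the two relations puts
    \<open>(c - d) * q c\<close> in \<open>M\<close>, hence also \<open>(z - c) * q c\<close>, and
    then 1.\<close>
  have "inj q"
  proof (rule injI, rule ccontr)
    fix c d assume eq: "q c = q d" and "c \<noteq> d"
    have "((z - ?C d) * q d - 1) - ((z - ?C c) * q c - 1) = ?C (c - d) * q c"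
      unfolding eq by (simp add: algebra_simps single_diff)
    then have "?C (c - d) * q c \<in> M"
      using M.diff[OF q[of d] q[of c]] by metis
    then have "(z - ?C c) * (?C (1 / (c - d)) * (?C (c - d) * q c)) \<in> M"
      by (intro M.mult[of "_ * (_ * q c)"] M.mult[of "_ * q c"])
    then have "(z - ?C c) * q c \<in> M"
      using \<open>c \<noteq> d\<close> by simp
    from M.diff[OF this q[of c]] show False
      using M.proper by simp
  qed
  define S where "S = q ` {c. Poly_Mapping.keys (q c) = K}"
  have "S \<subseteq> group_algebra.span ((\<lambda>k. Poly_Mapping.single k 1) ` K)"
    using in_span_monomials by (auto simp: S_def)
  moreover have "infinite S"
    using K \<open>inj q\<close> by (simp add: S_def finite_image_iff inj_on_subset)
  moreover have "finite K"
    using K by (metis (mono_tags, lifting) Collect_empty_eq finite.emptyI finite_keys)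
  ultimately have "group_algebra.dependent S"
    using group_algebra.independent_span_bound[of "(\<lambda>k. Poly_Mapping.single k 1) ` K" S] by blast
  then obtain t u where t: "finite t" "t \<subseteq> S" "(\<Sum>v\<in>t. ?C (u v) * v) = 0" "\<exists>v\<in>t. u v \<noteq> 0"
    unfolding group_algebra.dependent_explicit by blast
  obtain T where T: "finite T" "t = q ` T"
    using finite_subset_image[OF t(1) t(2)[unfolded S_def]] by blast
  define b where "b = u \<circ> q"
  have sum0: "(\<Sum>c\<in>T. ?C (b c) * q c) = 0"
    using t(3) \<open>inj q\<close> by (simp add: T(2) b_def sum.reindex inj_on_subset)
  obtain c0 where c0: "c0 \<in> T" "b c0 \<noteq> 0"
    using t(4) by (auto simp: T(2) b_def)
  \<comment> \<open>The numerator of the partial fraction sum with coefficients \<open>b c\<close>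
    and poles \<open>c\<close>. At the pole \<open>c0\<close> only one summand survives, so it is
    not zero.\<close>
  define p where "p = (\<Sum>c\<in>T. smult (b c) (\<Prod>d\<in>T - {c}. [:- d, 1:]))"
  have "poly p c0 = (\<Sum>c\<in>T. b c * (\<Prod>d\<in>T - {c}. c0 - d))"
    by (simp add: p_def poly_sum poly_prod)
  also have "\<dots> = b c0 * (\<Prod>d\<in>T - {c0}. c0 - d)"
    using T(1) c0(1) by (subst sum.remove[of _ c0]) (auto intro!: sum.neutral)
  also have "\<dots> \<noteq> 0"
    using c0(2) T(1) by auto
  finally have "p \<noteq> 0"
    by auto
  have ev: "eval_at z p = (\<Sum>c\<in>T. ?C (b c) * (\<Prod>d\<in>T - {c}. z - ?C d))"
    by (simp add: p_def eval_at_sum eval_at_prod single_uminus)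
  have ring: "B * (P * (y * r - 1)) = y * P * (B * r) - B * P" for B P y r :: "'k \<Rightarrow>\<^sub>0 complex"
    by (simp add: algebra_simps)
  define W where "W = (\<Prod>d\<in>T. z - ?C d)"
  \<comment> \<open>Modulo \<open>M\<close> each \<open>q c\<close> is the inverse of
    \<open>z - c\<close>, so multiplying the dependence relation by \<open>W\<close> turns it into
    \<open>eval_at z p\<close>.\<close>
  have "- (\<Sum>c\<in>T. ?C (b c) * ((\<Prod>d\<in>T - {c}. z - ?C d) * ((z - ?C c) * q c - 1))) \<in> M"
    using q by (intro module.subspace_neg[OF module_times M.ideal] M.sum M.mult)
  also have "(\<Sum>c\<in>T. ?C (b c) * ((\<Prod>d\<in>T - {c}. z - ?C d) * ((z - ?C c) * q c - 1)))
    = (\<Sum>c\<in>T. W * (?C (b c) * q c) - ?C (b c) * (\<Prod>d\<in>T - {c}. z - ?C d))"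
  proof (rule sum.cong)
    fix c assume "c \<in> T"
    then have "W = (z - ?C c) * (\<Prod>d\<in>T - {c}. z - ?C d)"
      unfolding W_def by (rule prod.remove[OF T(1)])
    then show "?C (b c) * ((\<Prod>d\<in>T - {c}. z - ?C d) * ((z - ?C c) * q c - 1))
      = W * (?C (b c) * q c) - ?C (b c) * (\<Prod>d\<in>T - {c}. z - ?C d)"
      by (simp only: ring)
  qed simp
  also have "\<dots> = - eval_at z p"
    by (simp add: sum_subtractf sum0 ev flip: sum_distrib_left)
  finally have "eval_at z p \<in> M"
    by simp
  then show False
    using no maximal_ideal_root[OF assms \<open>p \<noteq> 0\<close>] by blast
qed

section \<open>Evaluation at points of the complex torus\<close>

lemma int_vec_induct [case_names zero plus minus]:
  fixes k :: "int ^ 'd::finite"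
  assumes zero: "P 0" and plus: "\<And>k i. P k \<Longrightarrow> P (k + axis i 1)"
    and minus: "\<And>k i. P k \<Longrightarrow> P (k - axis i 1)"
  shows "P k"
proof (induction "\<Sum>i\<in>UNIV. nat \<bar>k $ i\<bar>" arbitrary: k rule: less_induct)
  case less
  show ?case
  proof (cases "k = 0")
    case False
    then obtain i where i: "k $ i \<noteq> 0"
      by (auto simp: vec_eq_iff)
    \<comment> \<open>A unit step towards the origin in a nonzero coordinate lowers the sum of
      absolute values.\<close>
    define e :: int where "e = sgn (k $ i)"
    have "(\<Sum>j\<in>UNIV. nat \<bar>(k - axis i e) $ j\<bar>) < (\<Sum>j\<in>UNIV. nat \<bar>k $ j\<bar>)"
    proof (rule sum_strict_mono_ex1)
      show "\<forall>j\<in>UNIV. nat \<bar>(k - axis i e) $ j\<bar> \<le> nat \<bar>k $ j\<bar>"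
        using i by (auto simp: axis_def e_def sgn_if)
      show "\<exists>j\<in>UNIV. nat \<bar>(k - axis i e) $ j\<bar> < nat \<bar>k $ j\<bar>"
        using i by (intro bexI[of _ i]) (auto simp: e_def sgn_if)
    qed simp
    then have P: "P (k - axis i e)"
      by (rule less)
    show ?thesis
    proof (cases "0 < k $ i")
      case True
      then show ?thesis
        using plus[OF P, of i] by (simp add: e_def)
    next
      case False
      then have "k = k - axis i e - axis i 1"
        using i by (simp add: e_def sgn_if vec_eq_iff axis_def)
      then show ?thesis
        using minus[OF P, of i] by metis
    qed
  qed (use zero in simp)
qed

text \<open>The duality between sequences and finitely supported functions. For
  \<open>g = gpow \<omega>\<close> it is the value of the Laurent polynomial \<open>f\<close> at
  \<open>\<omega>\<close>.\<close>

definition pairing :: "('a \<Rightarrow> complex) \<Rightarrow> ('a \<Rightarrow>\<^sub>0 complex) \<Rightarrow> complex" where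
  "pairing g f = (\<Sum>k\<in>Poly_Mapping.keys f. Poly_Mapping.lookup f k * g k)"

lemma pairing_superset:
  "finite K \<Longrightarrow> Poly_Mapping.keys f \<subseteq> K \<Longrightarrow> pairing g f = (\<Sum>k\<in>K. Poly_Mapping.lookup f k * g k)"
  unfolding pairing_def by (rule sum.mono_neutral_left) (auto simp: in_keys_iff)

lemma pairing_single [simp]: "pairing g (Poly_Mapping.single k c) = c * g k"
  by (simp add: pairing_def)

lemma pairing_zero [simp]: "pairing g 0 = 0"
  by (simp add: pairing_def)

lemma pairing_add: "pairing g (f + f') = pairing g f + pairing g f'"
proof -
  let ?K = "Poly_Mapping.keys f \<union> Poly_Mapping.keys f'"
  have "pairing g (f + f') = (\<Sum>k\<in>?K. Poly_Mapping.lookup (f + f') k * g k)"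
    by (rule pairing_superset) (simp_all add: keys_add)
  also have "\<dots> = (\<Sum>k\<in>?K. Poly_Mapping.lookup f k * g k) + (\<Sum>k\<in>?K. Poly_Mapping.lookup f' k * g k)"
    by (simp add: lookup_add distrib_right sum.distrib)
  also have "\<dots> = pairing g f + pairing g f'"
    by (simp flip: pairing_superset)
  finally show ?thesis .
qed

lemma pairing_diff: "pairing g (f - f') = pairing g f - pairing g f'"
  using pairing_add[of g "f - f'" f'] by simp

lemma pairing_scale_left: "pairing (\<lambda>k. c * g k) f = c * pairing g f"
  by (simp add: pairing_def sum_distrib_left mult_ac)

lemma pairing_diff_left: "pairing (\<lambda>k. g k - g' k) f = pairing g f - pairing g' f"
  by (simp add: pairing_def right_diff_distrib sum_subtractf)

text \<open>Multiplication by a monomial is adjoint to a translation; this is why annihilators of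
  invariant subspaces are submodules.\<close>

lemma pairing_single_times:
  fixes f :: "'a::comm_monoid_add \<Rightarrow>\<^sub>0 complex"
  shows "pairing g (Poly_Mapping.single a c * f) = c * pairing (\<lambda>k. g (k + a)) f"
proof (induction f rule: poly_mapping_add_induct)
  case (single k d)
  show ?case
    by (simp add: mult_single add.commute)
next
  case (add f f')
  then show ?case
    by (simp add: distrib_left pairing_add)
qed

lemma gpow_add:
  assumes "\<omega> \<in> Cstar"
  shows "gpow \<omega> (k + l) = gpow \<omega> k * gpow \<omega> l"
  using assms by (simp add: gpow_def Cstar_def power_int_add prod.distrib)

lemma gpow_0 [simp]: "gpow \<omega> 0 = 1"
  by (simp add: gpow_def)

lemma gpow_axis [simp]: "gpow \<omega> (axis i 1) = \<omega> $ i"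
proof -
  have "gpow \<omega> (axis i 1) = (\<Prod>j\<in>UNIV. if j = i then \<omega> $ j else 1)"
    unfolding gpow_def by (rule prod.cong) (auto simp: axis_def)
  then show ?thesis
    by simp
qed

lemma gpow_nonzero:
  assumes "\<omega> \<in> Cstar"
  shows "gpow \<omega> k \<noteq> 0"
  using assms by (simp add: gpow_def Cstar_def)

lemma pairing_gpow_mult:
  assumes "\<omega> \<in> Cstar"
  shows "pairing (gpow \<omega>) (f * g) = pairing (gpow \<omega>) f * pairing (gpow \<omega>) g"
proof (induction f rule: poly_mapping_add_induct)
  case (single a c)
  show ?case
    by (simp add: pairing_single_times gpow_add[OF assms] mult.commute[of "gpow \<omega> _" "gpow \<omega> a"]
        pairing_scale_left)
next
  case (add f f')
  then show ?case
    by (simp add: distrib_right pairing_add)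
qed

text \<open>Modulo a maximal ideal above \<open>I\<close> each variable is congruent to a constant
  \<open>\<omega> $ i\<close>, so every \<open>f\<close> is congruent to its value at
  \<open>\<omega>\<close>. The constants are nonzero because the variables are units.\<close>

lemma laurent_nullstellensatz:
  fixes I :: "'d::finite laurent set"
  assumes "module.subspace (*) I" "1 \<notin> I"
  shows "\<exists>\<omega>\<in>Cstar. \<forall>f\<in>I. pairing (gpow \<omega>) f = 0"
proof -
  let ?C = "Poly_Mapping.single 0 :: complex \<Rightarrow> 'd laurent"
  let ?z = "\<lambda>i. Poly_Mapping.single (axis i 1) 1 :: 'd laurent"
  let ?w = "\<lambda>i. Poly_Mapping.single (- axis i 1) 1 :: 'd laurent"
  obtain M where "maximal_ideal M" "I \<subseteq> M"
    using exists_maximal_ideal[OF assms] by blast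
  interpret M: maximal_ideal M by fact
  have wz: "?w i * ?z i = 1" for i
    by (simp add: mult_single)
  have zero: "0 \<in> M"
    by (rule module.subspace_0[OF module_times M.ideal])
  have "\<forall>i. \<exists>c. ?z i - ?C c \<in> M"
    using maximal_ideal_residue_field[OF \<open>maximal_ideal M\<close>] by blast
  then obtain w where w: "\<And>i. ?z i - ?C (w i) \<in> M"
    by metis
  define \<omega> where "\<omega> = (\<chi> i. w i)"
  have z\<omega>: "?z i - ?C (\<omega> $ i) \<in> M" for i
    using w by (simp add: \<omega>_def)
  have "\<omega> \<in> Cstar"
    unfolding Cstar_def
  proof (clarify)
    fix i assume "\<omega> $ i = 0"
    then have "?w i * ?z i \<in> M"
      using z\<omega>[of i] by (intro M.mult) simp
    then show False
      using M.proper wz by simp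
  qed
  have mon: "Poly_Mapping.single k 1 - ?C (gpow \<omega> k) \<in> M" for k
  proof (induction k rule: int_vec_induct)
    case zero
    show ?case
      using \<open>0 \<in> M\<close> by simp
  next
    case (plus k i)
    have "?z i * (Poly_Mapping.single k 1 - ?C (gpow \<omega> k)) + ?C (gpow \<omega> k) * (?z i - ?C (\<omega> $ i)) \<in> M"
      by (rule M.add[OF M.mult[OF plus] M.mult[OF z\<omega>]])
    also have "?z i * (Poly_Mapping.single k 1 - ?C (gpow \<omega> k)) + ?C (gpow \<omega> k) * (?z i - ?C (\<omega> $ i))
      = Poly_Mapping.single (k + axis i 1) 1 - ?C (gpow \<omega> (k + axis i 1))"
      by (simp add: right_diff_distrib mult_single gpow_add[OF \<open>\<omega> \<in> Cstar\<close>] add.commute)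
    finally show ?case .
  next
    case (minus k i)
    define l where "l = k - axis i 1"
    have k: "k = l + axis i 1"
      by (simp add: l_def)
    have "?w i * (Poly_Mapping.single k 1 - ?C (gpow \<omega> k)) - (?w i * ?C (gpow \<omega> l)) * (?z i - ?C (\<omega> $ i)) \<in> M"
      by (rule M.diff[OF M.mult[OF minus] M.mult[OF z\<omega>]])
    also have "?w i * (Poly_Mapping.single k 1 - ?C (gpow \<omega> k)) - (?w i * ?C (gpow \<omega> l)) * (?z i - ?C (\<omega> $ i))
      = Poly_Mapping.single l 1 - ?C (gpow \<omega> l)"
      by (simp add: k right_diff_distrib mult_single gpow_add[OF \<open>\<omega> \<in> Cstar\<close>])
    finally show ?case
      by (simp add: l_def)
  qed
  have resid: "f - ?C (pairing (gpow \<omega>) f) \<in> M" for f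
  proof (induction f rule: poly_mapping_add_induct)
    case (single k c)
    show ?case
      using M.mult[OF mon[of k], of "?C c"] by (simp add: right_diff_distrib mult_single)
  next
    case (add f g)
    then show ?case
      using M.add[OF add] by (simp add: pairing_add single_add algebra_simps)
  qed
  have "pairing (gpow \<omega>) f = 0" if "f \<in> I" for f
  proof (rule ccontr)
    let ?c = "pairing (gpow \<omega>) f"
    assume nz: "?c \<noteq> 0"
    have "f \<in> M"
      using that \<open>I \<subseteq> M\<close> by blast
    then have "?C ?c \<in> M"
      using M.diff[OF _ resid[of f]] by fastforce
    then have "?C (1 / ?c) * ?C ?c \<in> M"
      by (rule M.mult)
    with nz show False
      using M.proper by (simp add: mult_single)
  qed
  with \<open>\<omega> \<in> Cstar\<close> show ?thesis
    by blast
qed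

section \<open>Sequences annihilated by powers of difference operators\<close>

definition fwd_diff :: "'d::finite \<Rightarrow> (int ^ 'd \<Rightarrow> 'b::ab_group_add) \<Rightarrow> int ^ 'd \<Rightarrow> 'b" where
  "fwd_diff j v = (\<lambda>k. v (k + axis j 1) - v k)"

definition set_coord :: "'d::finite \<Rightarrow> int \<Rightarrow> int ^ 'd \<Rightarrow> int ^ 'd" where
  "set_coord j t k = (\<chi> i. if i = j then t else k $ i)"

text \<open>Newton coefficients in direction \<open>j\<close> live on the hyperplane where
  coordinate \<open>j\<close> is 0. Extending them constantly along \<open>j\<close> keeps the
  induction on coordinates within one type.\<close>

definition restrict0 :: "'d::finite \<Rightarrow> (int ^ 'd \<Rightarrow> 'b) \<Rightarrow> int ^ 'd \<Rightarrow> 'b" where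
  "restrict0 j v = (\<lambda>k. v (set_coord j 0 k))"

section \<open>Polynomial functions on the lattice and Newton's formula\<close>

definition polyfun :: "(int ^ 'd::finite \<Rightarrow> complex ^ 'r::finite) \<Rightarrow> bool" where
  "polyfun v \<longleftrightarrow> (\<exists>P c. finite (P :: ('d \<Rightarrow> nat) set) \<and>
      v = (\<lambda>k. \<Sum>\<alpha>\<in>P. (\<Prod>i\<in>UNIV. (of_int (k $ i)) ^ (\<alpha> i)) *s c \<alpha>))"

lemma polyfun_monomial:
  fixes c :: "complex ^ 'r::finite" and \<alpha> :: "'d::finite \<Rightarrow> nat"
  shows "polyfun (\<lambda>k. (\<Prod>i\<in>UNIV. (of_int (k $ i)) ^ (\<alpha> i)) *s c)"
  unfolding polyfun_def by (rule exI[of _ "{\<alpha>}"], rule exI[of _ "\<lambda>_. c"]) simp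

lemma polyfun_const: "polyfun (\<lambda>k. c)"
  using polyfun_monomial[of "\<lambda>_. 0" c] by simp

lemma polyfun_add:
  assumes "polyfun v" "polyfun w"
  shows "polyfun (\<lambda>k. v k + w k)"
proof -
  obtain P c where P: "finite P" "v = (\<lambda>k. \<Sum>\<alpha>\<in>P. (\<Prod>i\<in>UNIV. (of_int (k $ i)) ^ (\<alpha> i)) *s c \<alpha>)"
    using assms(1) by (auto simp: polyfun_def)
  obtain Q d where Q: "finite Q" "w = (\<lambda>k. \<Sum>\<alpha>\<in>Q. (\<Prod>i\<in>UNIV. (of_int (k $ i)) ^ (\<alpha> i)) *s d \<alpha>)"
    using assms(2) by (auto simp: polyfun_def)
  let ?c = "\<lambda>\<alpha>. (if \<alpha> \<in> P then c \<alpha> else 0) + (if \<alpha> \<in> Q then d \<alpha> else 0)"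
  have "v k + w k = (\<Sum>\<alpha>\<in>P \<union> Q. (\<Prod>i\<in>UNIV. (of_int (k $ i)) ^ (\<alpha> i)) *s ?c \<alpha>)" for k
  proof -
    have "v k = (\<Sum>\<alpha>\<in>P \<union> Q. (\<Prod>i\<in>UNIV. (of_int (k $ i)) ^ (\<alpha> i)) *s (if \<alpha> \<in> P then c \<alpha> else 0))"
      unfolding P(2) by (rule sum.mono_neutral_cong_left) (use P(1) Q(1) in auto)
    moreover have "w k = (\<Sum>\<alpha>\<in>P \<union> Q. (\<Prod>i\<in>UNIV. (of_int (k $ i)) ^ (\<alpha> i)) *s (if \<alpha> \<in> Q then d \<alpha> else 0))"
      unfolding Q(2) by (rule sum.mono_neutral_cong_left) (use P(1) Q(1) in auto)
    ultimately show ?thesis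
      by (simp only: vector_add_ldistrib sum.distrib)
  qed
  then show ?thesis
    unfolding polyfun_def using P(1) Q(1) by (intro exI[of _ "P \<union> Q"] exI[of _ ?c]) auto
qed

lemma polyfun_sum:
  assumes "\<And>x. x \<in> S \<Longrightarrow> polyfun (f x)"
  shows "polyfun (\<lambda>k. \<Sum>x\<in>S. f x k)"
  using assms by (induction S rule: infinite_finite_induct) (simp_all add: polyfun_const polyfun_add)

lemma polyfun_scale:
  assumes "polyfun v"
  shows "polyfun (\<lambda>k. a *s v k)"
proof -
  obtain P c where P: "v = (\<lambda>k. \<Sum>\<alpha>\<in>P. (\<Prod>i\<in>UNIV. (of_int (k $ i)) ^ (\<alpha> i)) *s c \<alpha>)"
    using assms by (auto simp: polyfun_def)
  have "(\<lambda>k. a *s v k) = (\<lambda>k. \<Sum>\<alpha>\<in>P. (\<Prod>i\<in>UNIV. (of_int (k $ i)) ^ (\<alpha> i)) *s (a *s c \<alpha>))"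
    by (simp add: P vec.scale_sum_right mult.commute)
  then show ?thesis
    by (simp only:) (intro polyfun_sum polyfun_monomial)
qed

lemma polyfun_mult_coord:
  fixes v :: "int ^ 'd::finite \<Rightarrow> complex ^ 'r::finite"
  assumes "polyfun v"
  shows "polyfun (\<lambda>k. of_int (k $ j) *s v k)"
proof -
  obtain P c where P: "v = (\<lambda>k. \<Sum>\<alpha>\<in>P. (\<Prod>i\<in>UNIV. (of_int (k $ i)) ^ (\<alpha> i)) *s c \<alpha>)"
    using assms by (auto simp: polyfun_def)
  have mon: "of_int (k $ j) * (\<Prod>i\<in>UNIV. of_int (k $ i) ^ \<alpha> i) = (\<Prod>i\<in>UNIV. (of_int (k $ i) :: complex) ^ (\<alpha>(j := Suc (\<alpha> j))) i)"
    for k :: "int ^ 'd" and \<alpha>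
  proof -
    have "(\<Prod>i\<in>UNIV - {j}. (of_int (k $ i) :: complex) ^ (\<alpha>(j := Suc (\<alpha> j))) i) = (\<Prod>i\<in>UNIV - {j}. of_int (k $ i) ^ \<alpha> i)"
      by (rule prod.cong) auto
    then show ?thesis
      by (simp add: prod.remove[of UNIV j] mult.assoc)
  qed
  have "(\<lambda>k. of_int (k $ j) *s v k) = (\<lambda>k. \<Sum>\<alpha>\<in>P. (\<Prod>i\<in>UNIV. (of_int (k $ i)) ^ ((\<alpha>(j := Suc (\<alpha> j))) i)) *s c \<alpha>)"
    by (simp only: P vec.scale_sum_right vector_smult_assoc mon)
  then show ?thesis
    by (simp only:) (intro polyfun_sum polyfun_monomial)
qed

text \<open>Induction by
  \<open>(m + 1) * (x gchoose (m + 1)) = (x - m) * (x gchoose m)\<close>.\<close>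

lemma polyfun_mult_gbinomial:
  assumes "polyfun v"
  shows "polyfun (\<lambda>k. (of_int (k $ j) gchoose m) *s v k)"
proof (induction m)
  case 0
  then show ?case
    using assms by simp
next
  case (Suc m)
  have "(of_int (k $ j) gchoose Suc m) *s v k =
      (1 / of_nat (Suc m)) *s (of_int (k $ j) *s ((of_int (k $ j) gchoose m) *s v k) +
        (- of_nat m) *s ((of_int (k $ j) gchoose m) *s v k))" for k
  proof -
    have "(of_int (k $ j) gchoose Suc m) =
      (1 / of_nat (Suc m)) * (of_int (k $ j) * (of_int (k $ j) gchoose m) + - of_nat m * (of_int (k $ j) gchoose m) :: complex)"
      using gbinomial_absorb_comp[of "of_int (k $ j) :: complex" m]
        gbinomial_absorption[of m "of_int (k $ j) :: complex"]
      by (simp add: field_simps del: of_nat_Suc)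
    then show ?thesis
      by (simp only: vector_smult_assoc vector_add_ldistrib[symmetric] vector_sadd_rdistrib[symmetric])
  qed
  then show ?case
    by (simp only:) (intro polyfun_scale polyfun_add polyfun_mult_coord Suc)
qed

text \<open>By Pascal's rule both sides have the same forward difference, and they agree at 0.
  Generalized binomials make this work for negative \<open>t\<close> as well.\<close>

lemma newton_forward:
  fixes f :: "int \<Rightarrow> complex ^ 'r::finite"
  defines "D \<equiv> (\<lambda>f (t::int). f (t + 1) - f t)"
  assumes "(D ^^ n) f = (\<lambda>_. 0)"
  shows "f t = (\<Sum>m<n. (of_int t gchoose m) *s (D ^^ m) f 0)"
  using assms(2)
proof (induction n arbitrary: f t)
  case 0
  then show ?case
    by simp
next
  case (Suc n)
  define h where "h t = f 0 + (\<Sum>m<n. (of_int t gchoose Suc m) *s (D ^^ Suc m) f 0)" for t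
  have "(D ^^ n) (D f) = (\<lambda>_. 0)"
    using Suc.prems unfolding funpow_Suc_right comp_apply .
  from Suc.IH[OF this] have Df: "D f t = (\<Sum>m<n. (of_int t gchoose m) *s (D ^^ Suc m) f 0)" for t
    unfolding funpow_Suc_right comp_apply .
  have step: "h (t + 1) - h t = f (t + 1) - f t" for t
  proof -
    have "h (t + 1) - h t = (\<Sum>m<n. ((of_int (t + 1) gchoose Suc m) - (of_int t gchoose Suc m)) *s (D ^^ Suc m) f 0)"
      by (simp only: h_def add_diff_cancel_left vec.scale_left_diff_distrib sum_subtractf)
    also have "\<dots> = D f t"
      unfolding Df by (simp add: gbinomial_Suc_Suc)
    finally show ?thesis
      by (simp add: D_def)
  qed
  have h0: "h 0 = f 0"
    by (simp add: h_def)
  have "f t = h t"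
  proof (induction t rule: int_induct[where k = 0])
    case base
    show ?case
      by (simp add: h0)
  next
    case (step1 i)
    then show ?case
      using step[of i] by simp
  next
    case (step2 i)
    then show ?case
      using step[of "i - 1"] by simp
  qed
  also have "h t = (\<Sum>m<Suc n. (of_int t gchoose m) *s (D ^^ m) f 0)"
    unfolding h_def by (subst sum.lessThan_Suc_shift) simp
  finally show ?case .
qed

lemma newton_coord:
  fixes v :: "int ^ 'd::finite \<Rightarrow> complex ^ 'r::finite"
  assumes "(fwd_diff j ^^ n) v = (\<lambda>_. 0)"
  shows "v k = (\<Sum>m<n. (of_int (k $ j) gchoose m) *s restrict0 j ((fwd_diff j ^^ m) v) k)"
proof -
  define D where "D = (\<lambda>(f :: int \<Rightarrow> complex ^ 'r) (t::int). f (t + 1) - f t)"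
  have D: "(D ^^ m) (\<lambda>t. v (set_coord j t k)) = (\<lambda>t. (fwd_diff j ^^ m) v (set_coord j t k))" for m
  proof (induction m)
    case (Suc m)
    have "set_coord j t k + axis j 1 = set_coord j (t + 1) k" for t
      by (simp add: set_coord_def vec_eq_iff axis_def)
    then show ?case
      unfolding funpow.simps comp_apply Suc by (simp add: D_def fwd_diff_def[of j "(fwd_diff j ^^ m) v"])
  qed simp
  have "set_coord j (k $ j) k = k"
    by (simp add: set_coord_def vec_eq_iff)
  moreover have "(D ^^ n) (\<lambda>t. v (set_coord j t k)) = (\<lambda>_. 0)"
    by (simp add: D assms)
  from newton_forward[OF this[unfolded D_def], of "k $ j"]
  have "v (set_coord j (k $ j) k) = (\<Sum>m<n. (of_int (k $ j) gchoose m) *s (fwd_diff j ^^ m) v (set_coord j 0 k))"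
    unfolding D_def[symmetric] D .
  ultimately show ?thesis
    by (simp add: restrict0_def)
qed

lemma fwd_diff_zero [simp]: "(fwd_diff j ^^ n) (\<lambda>_. 0) = (\<lambda>_. 0)"
  by (induction n) (simp_all add: fwd_diff_def)

lemma fwd_diff_commute: "fwd_diff i (fwd_diff j v) = fwd_diff j (fwd_diff i v)"
  by (simp add: fwd_diff_def fun_eq_iff algebra_simps)

lemma fwd_diff_funpow_commute: "fwd_diff i ((fwd_diff j ^^ m) v) = (fwd_diff j ^^ m) (fwd_diff i v)"
  by (induction m) (simp_all add: fwd_diff_commute[of i j])

lemma fwd_diff_restrict0: "i \<noteq> j \<Longrightarrow> fwd_diff i (restrict0 j v) = restrict0 j (fwd_diff i v)"
proof -
  assume "i \<noteq> j"
  then have "set_coord j 0 (k + axis i 1) = set_coord j 0 k + axis i 1" for k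
    by (simp add: set_coord_def vec_eq_iff axis_def)
  then show ?thesis
    by (simp add: fwd_diff_def restrict0_def)
qed

lemma fwd_diff_restrict0_same: "fwd_diff j (restrict0 j v) = (\<lambda>_. 0)"
proof -
  have "set_coord j 0 (k + axis j 1) = set_coord j 0 k" for k
    by (simp add: set_coord_def vec_eq_iff axis_def)
  then show ?thesis
    by (simp add: fwd_diff_def restrict0_def)
qed

text \<open>\<open>S\<close> contains the coordinates on which \<open>v\<close> may depend. The
  Newton coefficients in direction \<open>j\<close> no longer depend on \<open>j\<close>, and they
  inherit the other conditions because differences commute.\<close>

lemma polyfun_if_fwd_diff_nilpotent:
  fixes v :: "int ^ 'd::finite \<Rightarrow> complex ^ 'r::finite"
  assumes "finite S" "\<And>j. j \<in> S \<Longrightarrow> \<exists>n. (fwd_diff j ^^ n) v = (\<lambda>_. 0)"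
    and "\<And>j. j \<notin> S \<Longrightarrow> fwd_diff j v = (\<lambda>_. 0)"
  shows "polyfun v"
  using assms
proof (induction S arbitrary: v rule: finite_induct)
  case empty
  have inv: "v (k + axis j 1) = v k" for k j
    using empty(2)[of j] by (simp add: fwd_diff_def fun_eq_iff)
  have "v k = v 0" for k
  proof (induction k rule: int_vec_induct)
    case (minus k i)
    then show ?case
      using inv[of "k - axis i 1" i] by simp
  qed (simp_all add: inv)
  then have "v = (\<lambda>_. v 0)"
    by blast
  then show ?case
    using polyfun_const by metis
next
  case (insert j S)
  obtain n where n: "(fwd_diff j ^^ n) v = (\<lambda>_. 0)"
    using insert.prems(1) by blast
  have restrict0_zero: "restrict0 j (\<lambda>_. 0) = (\<lambda>_. 0)"
    by (simp add: restrict0_def)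
  have pow: "(fwd_diff i ^^ l) (restrict0 j ((fwd_diff j ^^ m) v)) = restrict0 j ((fwd_diff j ^^ m) ((fwd_diff i ^^ l) v))"
    if "i \<noteq> j" for i l m
    by (induction l) (simp_all add: fwd_diff_restrict0[OF that] fwd_diff_funpow_commute)
  have "polyfun (restrict0 j ((fwd_diff j ^^ m) v))" for m
  proof (rule insert.IH)
    fix i assume i: "i \<in> S"
    then obtain l where "(fwd_diff i ^^ l) v = (\<lambda>_. 0)"
      using insert.prems(1) by blast
    moreover have "i \<noteq> j"
      using i insert.hyps by blast
    ultimately show "\<exists>l. (fwd_diff i ^^ l) (restrict0 j ((fwd_diff j ^^ m) v)) = (\<lambda>_. 0)"
      using pow[of i l m] by (auto simp: restrict0_zero)
  next
    fix i assume i: "i \<notin> S"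
    show "fwd_diff i (restrict0 j ((fwd_diff j ^^ m) v)) = (\<lambda>_. 0)"
    proof (cases "i = j")
      case True
      then show ?thesis
        by (simp add: fwd_diff_restrict0_same)
    next
      case False
      then have "fwd_diff i v = (\<lambda>_. 0)"
        using i insert.prems(2) by blast
      then show ?thesis
        using pow[OF False, of 1 m] by (simp add: restrict0_zero)
    qed
  qed
  then have "polyfun (\<lambda>k. \<Sum>m<n. (of_int (k $ j) gchoose m) *s restrict0 j ((fwd_diff j ^^ m) v) k)"
    by (intro polyfun_sum polyfun_mult_gbinomial)
  also have "(\<lambda>k. \<Sum>m<n. (of_int (k $ j) gchoose m) *s restrict0 j ((fwd_diff j ^^ m) v) k) = v"
    by (rule ext, rule newton_coord[OF n, symmetric])
  finally show ?case .
qed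

text \<open>The adjoint of multiplication by the variable with index \<open>j\<close> minus
  \<open>\<omega> $ j\<close>.\<close>

definition twisted_diff :: "complex ^ 'd::finite \<Rightarrow> 'd \<Rightarrow> (int ^ 'd \<Rightarrow> complex ^ 'r::finite) \<Rightarrow> int ^ 'd \<Rightarrow> complex ^ 'r" where
  "twisted_diff \<omega> j u = (\<lambda>k. u (k + axis j 1) - (\<omega> $ j) *s u k)"

lemma pg_seq_if_twisted_diff_nilpotent:
  fixes u :: "int ^ 'd::finite \<Rightarrow> complex ^ 'r::finite"
  assumes \<omega>: "\<omega> \<in> Cstar" and nil: "\<And>j. \<exists>n. (twisted_diff \<omega> j ^^ n) u = (\<lambda>_. 0)"
  shows "pg_seq \<omega> u"
proof -
  \<comment> \<open>Dividing by \<open>gpow \<omega>\<close> turns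
    \<open>twisted_diff \<omega> j\<close> into \<open>\<omega> $ j\<close> times
    \<open>fwd_diff j\<close>.\<close>
  define G :: "(int ^ 'd \<Rightarrow> complex ^ 'r) \<Rightarrow> _" where "G u = (\<lambda>k. inverse (gpow \<omega> k) *s u k)" for u
  have nz: "\<omega> $ j \<noteq> 0" for j
    using \<omega> by (simp add: Cstar_def)
  have G: "(fwd_diff j ^^ n) (G u) = (\<lambda>k. inverse (\<omega> $ j) ^ n *s G ((twisted_diff \<omega> j ^^ n) u) k)" for j n
  proof (induction n)
    case (Suc n)
    show ?case
    proof (rule ext)
      fix k
      have "(fwd_diff j ^^ Suc n) (G u) k =
        inverse (\<omega> $ j) ^ n *s (G ((twisted_diff \<omega> j ^^ n) u) (k + axis j 1) - G ((twisted_diff \<omega> j ^^ n) u) k)"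
        by (simp add: Suc fwd_diff_def vec.scale_right_diff_distrib)
      also have "G w (k + axis j 1) - G w k = inverse (\<omega> $ j) *s G (twisted_diff \<omega> j w) k" for w
        using nz[of j] gpow_nonzero[OF \<omega>, of k]
        by (simp add: G_def twisted_diff_def gpow_add[OF \<omega>] vec_eq_iff field_simps)
      finally show "(fwd_diff j ^^ Suc n) (G u) k = inverse (\<omega> $ j) ^ Suc n *s G ((twisted_diff \<omega> j ^^ Suc n) u) k"
        by (simp add: mult.commute)
    qed
  qed simp
  have "polyfun (G u)"
  proof (rule polyfun_if_fwd_diff_nilpotent[of UNIV])
    fix j :: 'd
    obtain n where "(twisted_diff \<omega> j ^^ n) u = (\<lambda>_. 0)"
      using nil by blast
    then have "(fwd_diff j ^^ n) (G u) = (\<lambda>_. 0)"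
      unfolding G by (simp add: G_def)
    then show "\<exists>n. (fwd_diff j ^^ n) (G u) = (\<lambda>_. 0)"
      by blast
  qed auto
  then obtain P c where P: "finite P" "G u = (\<lambda>k. \<Sum>\<alpha>\<in>P. (\<Prod>i\<in>UNIV. (of_int (k $ i)) ^ (\<alpha> i)) *s c \<alpha>)"
    by (auto simp: polyfun_def)
  have "u = (\<lambda>k. gpow \<omega> k *s G u k)"
    using gpow_nonzero[OF \<omega>] by (simp add: G_def)
  then have "u = (\<lambda>k. gpow \<omega> k *s (\<Sum>\<alpha>\<in>P. (\<Prod>i\<in>UNIV. (of_int (k $ i)) ^ (\<alpha> i)) *s c \<alpha>))"
    unfolding P(2) .
  with P(1) show ?thesis
    unfolding pg_seq_def by blast
qed

section \<open>Duality\<close>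

text \<open>A basis of \<open>W\<close> stays independent when \<open>u\<close> is added, so values
  on it may be prescribed. It is applied both to sequences and to Laurent vectors.\<close>

lemma (in vector_space) exists_separating_functional:
  assumes W: "subspace W" and u: "u \<notin> W"
  shows "\<exists>\<psi>. Vector_Spaces.linear scale (*) \<psi> \<and> (\<forall>x\<in>W. \<psi> x = 0) \<and> \<psi> u = 1"
proof -
  interpret field: vector_space "(*) :: 'a \<Rightarrow> 'a \<Rightarrow> 'a"
    by unfold_locales (simp_all only: distrib_left distrib_right mult.assoc mult_1_left)
  interpret vector_space_pair scale "(*) :: 'a \<Rightarrow> 'a \<Rightarrow> 'a" ..
  obtain B where B: "B \<subseteq> W" "independent B" "W \<subseteq> span B"
    using maximal_independent_subset by blast
  have "u \<notin> span B"
    using span_minimal[OF B(1) W] u by blast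
  then have ind: "independent (insert u B)"
    using B(2) independent_insertI by blast
  define \<psi> where "\<psi> = construct (insert u B) (\<lambda>x. if x = u then 1 else 0)"
  have lin: "Vector_Spaces.linear scale (*) \<psi>"
    unfolding \<psi>_def by (rule linear_construct[OF ind])
  have "\<psi> b = 0" if "b \<in> B" for b
    unfolding \<psi>_def using that u B(1) by (subst construct_basis[OF ind]) auto
  then have "\<psi> x = 0" if "x \<in> W" for x
    using linear_eq_0_on_span[OF lin] that B(3) by blast
  moreover have "\<psi> u = 1"
    unfolding \<psi>_def by (subst construct_basis[OF ind]) auto
  ultimately show ?thesis
    using lin by blast
qed

interpretation seq_space: vector_space "cscale :: complex \<Rightarrow> ('a \<Rightarrow> complex ^ 'r::finite) \<Rightarrow> _"
  by unfold_locales (simp_all add: cscale_def fun_eq_iff vec_eq_iff algebra_simps)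

interpretation laurent_vector_space: vector_space
  "\<lambda>c (x :: 'd::finite laurent ^ 'r::finite). Poly_Mapping.single 0 c *s x"
  by unfold_locales
    (simp_all add: vector_add_ldistrib vector_sadd_rdistrib single_add vector_smult_assoc mult_single)

definition vpairing :: "(int ^ 'd::finite \<Rightarrow> complex ^ 'r::finite) \<Rightarrow> 'd laurent ^ 'r \<Rightarrow> complex" where
  "vpairing u x = (\<Sum>i\<in>UNIV. pairing (\<lambda>k. u k $ i) (x $ i))"

lemma vpairing_add_right: "vpairing u (x + y) = vpairing u x + vpairing u y"
  by (simp add: vpairing_def pairing_add sum.distrib)

lemma vpairing_zero_right: "vpairing u 0 = 0"
  by (simp add: vpairing_def)

lemma vpairing_diff_right: "vpairing u (x - y) = vpairing u x - vpairing u y"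
  by (simp add: vpairing_def pairing_diff sum_subtractf)

lemma vpairing_diff_left: "vpairing (\<lambda>k. u k - w k) x = vpairing u x - vpairing w x"
  by (simp add: vpairing_def pairing_diff_left sum_subtractf)

lemma vpairing_scale_left: "vpairing (\<lambda>k. c *s u k) x = c * vpairing u x"
  by (simp add: vpairing_def pairing_scale_left sum_distrib_left)

lemma vpairing_single_smult:
  "vpairing u (Poly_Mapping.single a c *s x) = c * vpairing (\<lambda>k. u (k + a)) x"
  by (simp add: vpairing_def pairing_single_times sum_distrib_left)

lemma vpairing_axis [simp]: "vpairing u (axis i f) = pairing (\<lambda>k. u k $ i) f"
proof -
  have "vpairing u (axis i f) = (\<Sum>j\<in>UNIV. if j = i then pairing (\<lambda>k. u k $ i) f else 0)"
    unfolding vpairing_def by (rule sum.cong) (auto simp: axis_def)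
  then show ?thesis
    by simp
qed

lemma vpairing_twisted_diff:
  "vpairing u ((Poly_Mapping.single (axis j 1) 1 - Poly_Mapping.single 0 (\<omega> $ j)) ^ n *s x)
    = vpairing ((twisted_diff \<omega> j ^^ n) u) x"
proof (induction n arbitrary: x)
  case (Suc n)
  let ?g = "Poly_Mapping.single (axis j 1) 1 - Poly_Mapping.single 0 (\<omega> $ j)"
  have step: "vpairing w (?g *s y) = vpairing (twisted_diff \<omega> j w) y" for w y
    by (simp add: vector_sub_rdistrib vpairing_diff_right vpairing_single_smult twisted_diff_def
        vpairing_diff_left vpairing_scale_left)
  have "vpairing u (?g ^ Suc n *s x) = vpairing u (?g ^ n *s (?g *s x))"
    by (simp only: power_Suc2 vector_smult_assoc)
  also have "\<dots> = vpairing ((twisted_diff \<omega> j ^^ Suc n) u) x"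
    by (simp only: Suc step funpow.simps comp_apply)
  finally show ?case .
qed simp

text \<open>Monomials in the coordinate directions form a complex basis, so the values on them,
  collected in \<open>u\<close>, determine the functional.\<close>

lemma linear_functional_eq_vpairing:
  fixes \<psi> :: "'d::finite laurent ^ 'r::finite \<Rightarrow> complex"
  assumes "Vector_Spaces.linear (\<lambda>c x. Poly_Mapping.single 0 c *s x) (*) \<psi>"
  shows "\<exists>u. \<forall>x. \<psi> x = vpairing u x"
proof -
  interpret \<psi>: Vector_Spaces.linear "\<lambda>c (x :: 'd laurent ^ 'r). Poly_Mapping.single 0 c *s x" "(*)" \<psi> by fact
  define u where "u k = (\<chi> i. \<psi> (axis i (Poly_Mapping.single k 1)))" for k
  have ax: "\<psi> (axis i f) = pairing (\<lambda>k. u k $ i) f" for i f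
  proof (induction f rule: poly_mapping_add_induct)
    case (single k c)
    have "axis i (Poly_Mapping.single k c) = Poly_Mapping.single 0 c *s axis i (Poly_Mapping.single k 1)"
      by (simp add: vec_eq_iff axis_def mult_single)
    then show ?case
      by (simp only: \<psi>.scale pairing_single) (simp add: u_def)
  next
    case (add f g)
    have "axis i (f + g) = axis i f + axis i g"
      by (simp add: vec_eq_iff axis_def)
    with add show ?case
      by (simp only: \<psi>.add pairing_add)
  qed
  have "\<psi> x = vpairing u x" for x
  proof -
    have "x = (\<Sum>i\<in>UNIV. axis i (x $ i))"
      by (simp add: vec_eq_iff axis_def)
    then have "\<psi> x = (\<Sum>i\<in>UNIV. \<psi> (axis i (x $ i)))"
      using \<psi>.sum[of "\<lambda>i. axis i (x $ i)" UNIV] by simp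
    then show ?thesis
      by (simp add: vpairing_def ax)
  qed
  then show ?thesis
    by blast
qed

text \<open>A basic neighbourhood of \<open>u\<close> off the closure restricts only a finite set
  \<open>F\<close> of positions. A functional that kills every sequence agreeing on \<open>F\<close>
  with a member of \<open>S\<close> sees only the values on \<open>F\<close>, so it is given by a
  finitely supported \<open>x\<close>.\<close>

lemma separation_from_closure:
  fixes S :: "(int ^ 'd::finite \<Rightarrow> complex ^ 'r::finite) set"
  assumes S: "seq_space.subspace S" and u: "u \<notin> closure S"
  shows "\<exists>x. (\<forall>a\<in>S. vpairing a x = 0) \<and> vpairing u x \<noteq> 0"
proof -
  have "openin (product_topology (\<lambda>i. euclidean) UNIV) (- closure S)"
    using open_fun_def[of "- closure S"] by (simp add: open_Compl)
  from product_topology_open_contains_basis[OF this, of u] u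
  obtain X where X: "u \<in> (\<Pi>\<^sub>E i\<in>UNIV. X i)" "finite {i. X i \<noteq> UNIV}" "(\<Pi>\<^sub>E i\<in>UNIV. X i) \<subseteq> - closure S"
    by auto
  define F where "F = {i. X i \<noteq> UNIV}"
  have "finite F"
    using X(2) by (simp add: F_def)
  define W where "W = {f. \<exists>a\<in>S. \<forall>k\<in>F. f k = a k}"
  have "u \<notin> W"
  proof
    assume "u \<in> W"
    then obtain a where a: "a \<in> S" "\<forall>k\<in>F. u k = a k"
      by (auto simp: W_def)
    have "a k \<in> X k" for k
    proof (cases "k \<in> F")
      case True
      then show ?thesis
        using a(2) X(1) by (metis PiE_mem UNIV_I)
    qed (simp add: F_def)
    then have "a \<in> - closure S"
      using X(3) by (auto simp: PiE_iff)
    then show False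
      using a(1) closure_subset[of S] by blast
  qed
  have "seq_space.subspace W"
  proof (rule seq_space.subspaceI)
    show "0 \<in> W"
      using seq_space.subspace_0[OF S] by (auto simp: W_def intro!: bexI[of _ 0])
    show "f + g \<in> W" if fg: "f \<in> W" "g \<in> W" for f g
    proof -
      obtain a b where "a \<in> S" "b \<in> S" "\<forall>k\<in>F. f k = a k" "\<forall>k\<in>F. g k = b k"
        using fg by (auto simp: W_def)
      then show ?thesis
        using seq_space.subspace_add[OF S, of a b] by (auto simp: W_def intro!: bexI[of _ "a + b"])
    qed
    show "cscale c f \<in> W" if f: "f \<in> W" for c f
    proof -
      obtain a where "a \<in> S" "\<forall>k\<in>F. f k = a k"
        using f by (auto simp: W_def)
      then show ?thesis
        using seq_space.subspace_scale[OF S, of a c] by (auto simp: W_def cscale_def intro!: bexI[of _ "\<lambda>k. c *s a k"])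
    qed
  qed
  then obtain \<psi> where "Vector_Spaces.linear cscale (*) \<psi>" and \<psi>W: "\<And>f. f \<in> W \<Longrightarrow> \<psi> f = 0" and \<psi>u: "\<psi> u = 1"
    using seq_space.exists_separating_functional[OF _ \<open>u \<notin> W\<close>] by blast
  then interpret \<psi>: Vector_Spaces.linear cscale "(*)" \<psi> by simp
  define \<delta> :: "int ^ 'd \<Rightarrow> 'r \<Rightarrow> int ^ 'd \<Rightarrow> complex ^ 'r" where
    "\<delta> k i = (\<lambda>l. if l = k then axis i 1 else 0)" for k i
  define x :: "'d laurent ^ 'r" where "x = (\<chi> i. \<Sum>k\<in>F. Poly_Mapping.single k (\<psi> (\<delta> k i)))"
  have "\<psi> f = vpairing f x" for f
  proof -
    define g where "g = (\<Sum>i\<in>UNIV. \<Sum>k\<in>F. cscale (f k $ i) (\<delta> k i))"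
    have sum_fun: "(\<Sum>a\<in>T. h a) l = (\<Sum>a\<in>T. h a l)" for T l and h :: "'z \<Rightarrow> int ^ 'd \<Rightarrow> complex ^ 'r"
      by (induction T rule: infinite_finite_induct) auto
    have "g l = f l" if "l \<in> F" for l
    proof -
      have "g l = (\<Sum>i\<in>UNIV. \<Sum>k\<in>F. if k = l then f l $ i *s axis i 1 else 0)"
        unfolding g_def sum_fun by (intro sum.cong) (auto simp: cscale_def \<delta>_def)
      also have "\<dots> = (\<Sum>i\<in>UNIV. f l $ i *s axis i 1)"
        using that \<open>finite F\<close> by simp
      also have "\<dots> = f l"
        by (simp add: vec_eq_iff axis_def if_distrib cong: if_cong)
      finally show ?thesis .
    qed
    \<comment> \<open>The difference vanishes on \<open>F\<close>, where it agrees with the member 0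
      of \<open>S\<close>.\<close>
    then have "f - g \<in> W"
      using seq_space.subspace_0[OF S] by (auto simp: W_def intro!: bexI[of _ 0])
    then have "\<psi> f = \<psi> g"
      using \<psi>W[of "f - g"] by (simp add: \<psi>.diff)
    also have "\<dots> = (\<Sum>i\<in>UNIV. \<Sum>k\<in>F. f k $ i * \<psi> (\<delta> k i))"
      by (simp add: g_def \<psi>.sum \<psi>.scale)
    also have "\<dots> = vpairing f x"
    proof -
      have "pairing h (\<Sum>k\<in>F. Poly_Mapping.single k (c k)) = (\<Sum>k\<in>F. c k * h k)" for h c
        using \<open>finite F\<close> by (induction F rule: finite_induct) (simp_all add: pairing_add)
      then show ?thesis
        by (simp add: vpairing_def x_def mult.commute)
    qed
    finally show ?thesis .
  qed
  moreover have "S \<subseteq> W"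
    by (auto simp: W_def)
  ultimately show ?thesis
    using \<psi>W \<psi>u by (intro exI[of _ x]) (metis subsetD zero_neq_one)
qed

text \<open>Since \<open>shift i\<close> maps \<open>A\<close> onto \<open>A\<close>, inverse shifts
  preserve \<open>A\<close> too; hence \<open>J\<close> is a module over Laurent polynomials and not
  just over polynomials.\<close>

lemma invariant_subspace_translate:
  assumes inv: "invariant_subspace A" and "u \<in> A"
  shows "(\<lambda>k. u (k + a)) \<in> A"
proof (induction a rule: int_vec_induct)
  case zero
  show ?case
    using \<open>u \<in> A\<close> by simp
next
  case (plus a i)
  have "shift i ` A = A"
    using inv by (simp add: invariant_subspace_def)
  then obtain w where w: "w \<in> A" "(\<lambda>k. u (k + a)) = shift i w"
    using plus by blast
  have "w = (\<lambda>k. u (k + (a + axis i 1)))"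
  proof
    fix k
    have "shift i w (k + axis i 1) = u (k + axis i 1 + a)"
      by (simp flip: w(2))
    then show "w k = u (k + (a + axis i 1))"
      by (simp add: shift_def add_ac)
  qed
  with w(1) show ?case
    by simp
next
  case (minus a i)
  have "shift i (\<lambda>k. u (k + a)) \<in> A"
    using inv minus by (auto simp: invariant_subspace_def)
  then show ?case
    by (simp add: shift_def algebra_simps)
qed

theorem theorem4p10:
  fixes A :: "(int ^ 'd::finite \<Rightarrow> complex ^ 'r::finite) set"
  assumes "module.subspace cscale A"
    and "closed A"
    and "invariant_subspace A"
  shows "\<exists>\<Omega>. finite \<Omega> \<and> \<Omega> \<subseteq> Cstar \<and>
           A = closure (module.span cscale {u \<in> A. \<exists>\<omega>\<in>\<Omega>. pg_seq \<omega> u})"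
proof -
  define J where "J = {x. \<forall>u\<in>A. vpairing u x = 0}"
  have J: "laurent_module.subspace J"
  proof (rule laurent_module.subspaceI)
    show "0 \<in> J"
      by (simp add: J_def vpairing_zero_right)
    show "x + y \<in> J" if "x \<in> J" "y \<in> J" for x y
      using that by (simp add: J_def vpairing_add_right)
    show "f *s x \<in> J" if x: "x \<in> J" for f x
    proof (induction f rule: poly_mapping_add_induct)
      case (single a c)
      show ?case
        using x invariant_subspace_translate[OF assms(3), of _ a] by (simp add: J_def vpairing_single_smult)
    next
      case (add f g)
      then show ?case
        by (simp add: J_def vector_sadd_rdistrib vpairing_add_right)
    qed
  qed
  let ?sep = "\<lambda>y \<omega> K. laurent_module.subspace K \<and> J \<subseteq> K \<and> y \<notin> K \<and>
      (\<forall>g. pairing (gpow \<omega>) g = 0 \<longrightarrow> (\<exists>n. \<forall>x. g ^ n *s x \<in> K))"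
  have "\<exists>\<Omega>\<subseteq>Cstar. finite \<Omega> \<and> (\<forall>y. y \<notin> J \<longrightarrow> (\<exists>\<omega>\<in>\<Omega>. \<exists>K. ?sep y \<omega> K))"
    by (rule laurent_module.finite_separating_points[OF _ pairing_diff pairing_gpow_mult laurent_nullstellensatz J])
      (simp_all flip: single_one)
  then obtain \<Omega> where \<Omega>: "\<Omega> \<subseteq> Cstar" "finite \<Omega>"
    and sep: "\<And>y. y \<notin> J \<Longrightarrow> \<exists>\<omega>\<in>\<Omega>. \<exists>K. ?sep y \<omega> K"
    by blast
  define B where "B = {u \<in> A. \<exists>\<omega>\<in>\<Omega>. pg_seq \<omega> u}"
  have "A \<subseteq> closure (seq_space.span B)"
  proof (rule subsetI, rule ccontr)
    fix u assume "u \<in> A" "u \<notin> closure (seq_space.span B)"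
    then obtain y where y: "\<And>a. a \<in> seq_space.span B \<Longrightarrow> vpairing a y = 0" "vpairing u y \<noteq> 0"
      using separation_from_closure[OF seq_space.subspace_span] by blast
    have "y \<notin> J"
      using y(2) \<open>u \<in> A\<close> by (auto simp: J_def)
    from sep[OF this] obtain \<omega> K where \<omega>: "\<omega> \<in> \<Omega>" and "?sep y \<omega> K"
      by (elim bexE exE)
    then have K: "laurent_module.subspace K" "J \<subseteq> K" "y \<notin> K"
      and nil: "\<And>g. pairing (gpow \<omega>) g = 0 \<Longrightarrow> \<exists>n. \<forall>x. g ^ n *s x \<in> K"
      by simp_all
    have "laurent_vector_space.subspace K"
      using K(1) by (auto simp: laurent_module.subspace_def laurent_vector_space.subspace_def)
    from laurent_vector_space.exists_separating_functional[OF this K(3)]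
    obtain \<psi> where \<psi>: "Vector_Spaces.linear (\<lambda>c x. Poly_Mapping.single 0 c *s x) (*) \<psi>"
      "\<And>x. x \<in> K \<Longrightarrow> \<psi> x = 0" "\<psi> y = 1"
      by blast
    obtain w where w: "\<And>x. \<psi> x = vpairing w x"
      using linear_functional_eq_vpairing[OF \<psi>(1)] by blast
    \<comment> \<open>The bipolar argument: outside the closed space \<open>A\<close>, some
      \<open>x \<in> J\<close> would satisfy \<open>vpairing w x \<noteq> 0\<close>, yet
      \<open>w\<close> kills \<open>K\<close> and so \<open>J\<close>.\<close>
    have "w \<in> A"
    proof (rule ccontr)
      assume "w \<notin> A"
      then obtain x where "\<forall>a\<in>A. vpairing a x = 0" "vpairing w x \<noteq> 0"
        using separation_from_closure[OF assms(1)] closure_closed[OF assms(2)] by blast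
      then show False
        using \<psi>(2)[of x] w K(2) by (auto simp: J_def)
    qed
    moreover have "pg_seq \<omega> w"
    proof (rule pg_seq_if_twisted_diff_nilpotent)
      show "\<omega> \<in> Cstar"
        using \<omega> \<Omega>(1) by blast
      fix j
      let ?g = "Poly_Mapping.single (axis j 1) 1 - Poly_Mapping.single 0 (\<omega> $ j)"
      have "pairing (gpow \<omega>) ?g = 0"
        by (simp add: pairing_diff)
      then obtain n where n: "\<And>x. ?g ^ n *s x \<in> K"
        using nil by blast
      have "vpairing ((twisted_diff \<omega> j ^^ n) w) x = 0" for x
        using \<psi>(2)[OF n[of x]] by (simp add: w vpairing_twisted_diff)
      \<comment> \<open>Pairing with a single monomial reads off one entry of the sequence.\<close>
      from this[of "axis i (Poly_Mapping.single k 1)" for i k]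
      have "(twisted_diff \<omega> j ^^ n) w = (\<lambda>_. 0)"
        by (simp add: fun_eq_iff vec_eq_iff)
      then show "\<exists>n. (twisted_diff \<omega> j ^^ n) w = (\<lambda>_. 0)"
        by blast
    qed
    ultimately have "w \<in> B"
      using \<omega> by (auto simp: B_def)
    then show False
      using y(1)[OF seq_space.span_base] \<psi>(3) w[of y] by simp
  qed
  moreover have "closure (seq_space.span B) \<subseteq> A"
    by (intro closure_minimal seq_space.span_minimal assms) (auto simp: B_def)
  ultimately show ?thesis
    using \<Omega> unfolding B_def by blast
qed

end
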